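(* For any algebra $A$ over a (coloured symmetric) set-operad $Q$ the twisted arrow operad $\mathrm{TwOp}_Q(A)$ is isomorphic to the operad $\mathcal U\mathrm{Op}_{(Q,A)^+}(\mathrm{id}_A)$ and to the operad $(\mathcal U\mathrm{Op}_Q(A),\mathrm{id}_A)^+$. The category of $\mathrm{TwOp}_Q(A)$-algebras is equivalent to the category of $Q$-algebras $B$ over and under $A$ (i.e. endowed with $Q$-algebra maps $A\to B$ and $B\to A$) such that the composite map $A\to B\to A$ is the identity map.
   Context: Let $Q$ be a $C$-coloured symmetric operad in sets and $A$ a $Q$-algebra. For variables $x_1,\dots,x_m$ with colours $c_1,\dots,c_m$, let $F(x_1,\dots,x_m)$ be the free $Q$-algebra on them and $F(x_1,\dots,x_m)\sqcup A$ the coproduct of $Q$-algebras. Its elements are represented by expressions $q(\dots)$ in variables and elements of $A$; the multiset of variables occurring in an element is well defined. An element is called multilinear here if every $x_i$ occurs exactly once; it can then be written as $[q(x_1,\dots,x_m,a_1,\dots,a_n)]$ with $q\in Q$, $a_j\in A$. **Enveloping operad** $\mathcal U\mathrm{Op}_Q(A)$: the $C$-coloured operad with $\mathcal U\mathrm{Op}_Q(A)(c_1,\dots,c_m;c_0)$ the set of multilinear elements of $F(x_1,\dots,x_m)\sqcup A$ of output colour $c_0$. **Baez–Dolan plus construction** $(Q,A)^+$: the operad whose colours are the elements of $A$, with $(Q,A)^+(a'_1,\dots,a'_m;a'_0)$ the set of multilinear elements of $F(x_1,\dots,x_m)$ ($x_i$ of the colour of $a'_i$), i.e. operations $q\in Q$,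 with $q(a'_1,\dots,a'_m)=a'_0$. **Twisted arrow operad** $\mathrm{TwOp}_Q(A)$: the operad whose colours are the elements of $A$, with $\mathrm{TwOp}_Q(A)(a'_1,\dots,a'_m;a'_0)$ the set of multilinear elements $[q(x_1,\dots,x_m,a_1,\dots,a_n)]$ of $F(x_1,\dots,x_m)\sqcup A$ ($x_i$ of the colour of $a'_i$) whose evaluation $q(a'_1,\dots,a'_m,a_1,\dots,a_n)$ equals $a'_0$. In all three cases composition $\circ_i$ is substitution for $x_i$, symmetric groups permute the order of variables, and identities are the elements $[x]$. $(Q,A)^+$-algebras are equivalent to $Q$-algebras over $A$, and $\mathrm{id}_A$ denotes the $(Q,A)^+$-algebra corresponding to $\mathrm{id}:A\to A$ (all its sets are singletons). $\mathcal U\mathrm{Op}_Q(A)$-algebras are equivalent to $Q$-algebras under $A$, and $\mathrm{id}_A$ also denotes the $\mathcal U\mathrm{Op}_Q(A)$-algebra corresponding to $\mathrm{id}:A\to A$ (with underlying sets $A(c)$). *)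

theory Defs
  imports "HOL-Library.FuncSet" "HOL-Library.Multiset" "HOL-Combinatorics.Permutations"
begin

section \<open>Coloured symmetric operads in sets and their algebras\<close>

text \<open>
  A family of sets \<open>Q(c\<^sub>1,\<dots>,c\<^sub>m;c\<^sub>0)\<close> is encoded by its total set \<open>ops Q\<close> together with the
  functions \<open>inputs\<close> and \<open>result\<close>. Likewise the family of underlying sets of an algebra is encoded
  by its total set \<open>carrier A\<close> with the function \<open>col\<close>, so that \<open>A(c)\<close> is the fibre of \<open>col\<close>
  over \<open>c\<close>. Inputs are numbered from 0. \<open>pcomp Q q i r\<close> is \<open>q \<circ>\<^sub>i r\<close>.
  The operation \<open>act Q q \<sigma>\<close> is characterised by
  \<open>(q\<sigma>)(a\<^bsub>\<sigma> 0\<^esub>,\<dots>,a\<^bsub>\<sigma> (n-1)\<^esub>) = q(a\<^bsub>0\<^esub>,\<dots>,a\<^bsub>n-1\<^esub>)\<close>; this is a right action.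
\<close>

record ('c, 'q) operad =
  colours :: "'c set"
  ops :: "'q set"
  inputs :: "'q \<Rightarrow> 'c list"
  result :: "'q \<Rightarrow> 'c"
  unit :: "'c \<Rightarrow> 'q"
  pcomp :: "'q \<Rightarrow> nat \<Rightarrow> 'q \<Rightarrow> 'q"
  act :: "'q \<Rightarrow> (nat \<Rightarrow> nat) \<Rightarrow> 'q"

definition insert_at :: "'x list \<Rightarrow> nat \<Rightarrow> 'x list \<Rightarrow> 'x list" where
  "insert_at xs i ys = take i xs @ ys @ drop (Suc i) xs"

text \<open>
  The permutation \<open>\<sigma> \<circ>\<^sub>i \<tau>\<close>, where \<open>\<tau>\<close> permutes \<open>m\<close> letters: \<open>\<tau>\<close> acts inside the block of length
  \<open>m\<close> put in place of the letter \<open>i\<close>, and \<open>\<sigma>\<close> moves the block and the remaining letters.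
\<close>

definition perm_pcomp :: "(nat \<Rightarrow> nat) \<Rightarrow> nat \<Rightarrow> nat \<Rightarrow> (nat \<Rightarrow> nat) \<Rightarrow> nat \<Rightarrow> nat" where
  "perm_pcomp \<sigma> i m \<tau> p =
     (let shift = (\<lambda>j. if j < \<sigma> i then j else j + m - 1) in
      if p < i then shift (\<sigma> p)
      else if p < i + m then \<sigma> i + \<tau> (p - i)
      else shift (\<sigma> (p + 1 - m)))"

definition composable :: "('c, 'q) operad \<Rightarrow> 'q \<Rightarrow> nat \<Rightarrow> 'q \<Rightarrow> bool" where
  "composable Q q i r \<longleftrightarrow> q \<in> ops Q \<and> r \<in> ops Q \<and> i < length (inputs Q q)
     \<and> result Q r = inputs Q q ! i"

locale operad =
  fixes Q :: "('c, 'q) operad"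
  assumes inputs_closed: "q \<in> ops Q \<Longrightarrow> set (inputs Q q) \<subseteq> colours Q"
    and result_closed: "q \<in> ops Q \<Longrightarrow> result Q q \<in> colours Q"
    and unit_ops: "c \<in> colours Q \<Longrightarrow> unit Q c \<in> ops Q"
    and inputs_unit: "c \<in> colours Q \<Longrightarrow> inputs Q (unit Q c) = [c]"
    and result_unit: "c \<in> colours Q \<Longrightarrow> result Q (unit Q c) = c"
    and pcomp_ops: "composable Q q i r \<Longrightarrow> pcomp Q q i r \<in> ops Q"
    and inputs_pcomp: "composable Q q i r
          \<Longrightarrow> inputs Q (pcomp Q q i r) = insert_at (inputs Q q) i (inputs Q r)"
    and result_pcomp: "composable Q q i r \<Longrightarrow> result Q (pcomp Q q i r) = result Q q"
    and act_ops: "q \<in> ops Q \<Longrightarrow> \<sigma> permutes {..<length (inputs Q q)} \<Longrightarrow> act Q q \<sigma> \<in> ops Q"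
    and inputs_act: "q \<in> ops Q \<Longrightarrow> \<sigma> permutes {..<length (inputs Q q)}
          \<Longrightarrow> inputs Q (act Q q \<sigma>) = permute_list \<sigma> (inputs Q q)"
    and result_act: "q \<in> ops Q \<Longrightarrow> \<sigma> permutes {..<length (inputs Q q)}
          \<Longrightarrow> result Q (act Q q \<sigma>) = result Q q"
    and unit_left: "q \<in> ops Q \<Longrightarrow> pcomp Q (unit Q (result Q q)) 0 q = q"
    and unit_right: "q \<in> ops Q \<Longrightarrow> i < length (inputs Q q)
          \<Longrightarrow> pcomp Q q i (unit Q (inputs Q q ! i)) = q"
    and assoc_sequential: "composable Q q i r \<Longrightarrow> composable Q r j s
          \<Longrightarrow> pcomp Q (pcomp Q q i r) (i + j) s = pcomp Q q i (pcomp Q r j s)"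
    and assoc_parallel: "composable Q q i r \<Longrightarrow> composable Q q k s \<Longrightarrow> i < k
          \<Longrightarrow> pcomp Q (pcomp Q q i r) (k + length (inputs Q r) - 1) s
            = pcomp Q (pcomp Q q k s) i r"
    and act_id: "q \<in> ops Q \<Longrightarrow> act Q q id = q"
    and act_act: "q \<in> ops Q \<Longrightarrow> \<sigma> permutes {..<length (inputs Q q)}
          \<Longrightarrow> \<tau> permutes {..<length (inputs Q q)} \<Longrightarrow> act Q (act Q q \<sigma>) \<tau> = act Q q (\<sigma> \<circ> \<tau>)"
    and equivariance: "\<sigma> permutes {..<length (inputs Q q)} \<Longrightarrow> i < length (inputs Q q)
          \<Longrightarrow> composable Q q (\<sigma> i) r \<Longrightarrow> \<tau> permutes {..<length (inputs Q r)}
          \<Longrightarrow> pcomp Q (act Q q \<sigma>) i (act Q r \<tau>)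
            = act Q (pcomp Q q (\<sigma> i) r) (perm_pcomp \<sigma> i (length (inputs Q r)) \<tau>)"

text \<open>Isomorphisms of operads; \<open>\<phi>\<close> is the map of colours and \<open>\<Phi>\<close> the map of operations.\<close>

definition operad_iso ::
  "('c, 'q) operad \<Rightarrow> ('d, 'r) operad \<Rightarrow> ('c \<Rightarrow> 'd) \<Rightarrow> ('q \<Rightarrow> 'r) \<Rightarrow> bool" where
  "operad_iso P R \<phi> \<Phi> \<longleftrightarrow>
     bij_betw \<phi> (colours P) (colours R) \<and> bij_betw \<Phi> (ops P) (ops R)
     \<and> (\<forall>q\<in>ops P. inputs R (\<Phi> q) = map \<phi> (inputs P q) \<and> result R (\<Phi> q) = \<phi> (result P q))
     \<and> (\<forall>c\<in>colours P. \<Phi> (unit P c) = unit R (\<phi> c))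
     \<and> (\<forall>q i r. composable P q i r \<longrightarrow> \<Phi> (pcomp P q i r) = pcomp R (\<Phi> q) i (\<Phi> r))
     \<and> (\<forall>q\<in>ops P. \<forall>\<sigma>. \<sigma> permutes {..<length (inputs P q)} \<longrightarrow> \<Phi> (act P q \<sigma>) = act R (\<Phi> q) \<sigma>)"

text \<open>Isomorphism of operads with the same set of colours, the identity on colours.\<close>

definition isomorphic_operads :: "('c, 'q) operad \<Rightarrow> ('c, 'r) operad \<Rightarrow> bool" where
  "isomorphic_operads P R \<longleftrightarrow> (\<exists>\<Phi>. operad_iso P R (\<lambda>c. c) \<Phi>)"

record ('c, 'q, 'a) algebra =
  carrier :: "'a set"
  col :: "'a \<Rightarrow> 'c"
  eval :: "'q \<Rightarrow> 'a list \<Rightarrow> 'a"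

definition evaluable :: "('c, 'q) operad \<Rightarrow> ('c, 'q, 'a) algebra \<Rightarrow> 'q \<Rightarrow> 'a list \<Rightarrow> bool" where
  "evaluable Q A q as \<longleftrightarrow> q \<in> ops Q \<and> set as \<subseteq> carrier A \<and> map (col A) as = inputs Q q"

locale operad_algebra =
  fixes Q :: "('c, 'q) operad" and A :: "('c, 'q, 'a) algebra"
  assumes col_closed: "a \<in> carrier A \<Longrightarrow> col A a \<in> colours Q"
    and eval_closed: "evaluable Q A q as \<Longrightarrow> eval A q as \<in> carrier A"
    and col_eval: "evaluable Q A q as \<Longrightarrow> col A (eval A q as) = result Q q"
    and eval_unit: "a \<in> carrier A \<Longrightarrow> eval A (unit Q (col A a)) [a] = a"
    and eval_pcomp: "evaluable Q A r bs \<Longrightarrow> evaluable Q A q (as @ eval A r bs # as')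
          \<Longrightarrow> eval A (pcomp Q q (length as) r) (as @ bs @ as') = eval A q (as @ eval A r bs # as')"
    and eval_act: "evaluable Q A q as \<Longrightarrow> \<sigma> permutes {..<length as}
          \<Longrightarrow> eval A (act Q q \<sigma>) (permute_list \<sigma> as) = eval A q as"

definition algebra_hom ::
  "('c, 'q) operad \<Rightarrow> ('c, 'q, 'a) algebra \<Rightarrow> ('c, 'q, 'b) algebra \<Rightarrow> ('a \<Rightarrow> 'b) set" where
  "algebra_hom Q A B =
     {f \<in> carrier A \<rightarrow>\<^sub>E carrier B.
        (\<forall>a\<in>carrier A. col B (f a) = col A a)
        \<and> (\<forall>q as. evaluable Q A q as \<longrightarrow> f (eval A q as) = eval B q (map f as))}"


section \<open>The coproduct of a free algebra with a given algebra\<close>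

text \<open>
  For a list \<open>cs\<close> of colours, \<open>F(x\<^sub>0,\<dots>,x\<^bsub>m-1\<^esub>) \<squnion> A\<close>, with \<open>m = length cs\<close> and \<open>x\<^sub>i\<close> of colour
  \<open>cs ! i\<close>, consists of the expressions built from the variables and the elements of \<open>A\<close> by
  means of the operations of \<open>Q\<close>, modulo the congruence generated by the axioms of \<open>Q\<close>-algebras
  and by the operations of \<open>A\<close>.
\<close>

datatype ('q, 'a) expr = Var nat | Elem 'a | App 'q "('q, 'a) expr list"

fun expr_col :: "('c, 'q) operad \<Rightarrow> ('c, 'q, 'a) algebra \<Rightarrow> 'c list \<Rightarrow> ('q, 'a) expr \<Rightarrow> 'c" where
  "expr_col Q A cs (Var j) = cs ! j"
| "expr_col Q A cs (Elem a) = col A a"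
| "expr_col Q A cs (App q ts) = result Q q"

fun wf_expr :: "('c, 'q) operad \<Rightarrow> ('c, 'q, 'a) algebra \<Rightarrow> 'c list \<Rightarrow> ('q, 'a) expr \<Rightarrow> bool" where
  "wf_expr Q A cs (Var j) \<longleftrightarrow> j < length cs"
| "wf_expr Q A cs (Elem a) \<longleftrightarrow> a \<in> carrier A"
| "wf_expr Q A cs (App q ts) \<longleftrightarrow>
     q \<in> ops Q \<and> map (expr_col Q A cs) ts = inputs Q q \<and> (\<forall>t\<in>set ts. wf_expr Q A cs t)"

inductive expr_eq ::
  "('c, 'q) operad \<Rightarrow> ('c, 'q, 'a) algebra \<Rightarrow> 'c list \<Rightarrow> ('q, 'a) expr \<Rightarrow> ('q, 'a) expr \<Rightarrow> bool"
  for Q A cs where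
  expr_refl: "wf_expr Q A cs t \<Longrightarrow> expr_eq Q A cs t t"
| expr_sym: "expr_eq Q A cs t u \<Longrightarrow> expr_eq Q A cs u t"
| expr_trans: "expr_eq Q A cs t u \<Longrightarrow> expr_eq Q A cs u v \<Longrightarrow> expr_eq Q A cs t v"
| expr_cong: "wf_expr Q A cs (App q ts) \<Longrightarrow> list_all2 (expr_eq Q A cs) ts us
    \<Longrightarrow> expr_eq Q A cs (App q ts) (App q us)"
| expr_unit: "wf_expr Q A cs t \<Longrightarrow> expr_eq Q A cs (App (unit Q (expr_col Q A cs t)) [t]) t"
| expr_pcomp: "wf_expr Q A cs (App q (ts @ App r us # ts'))
    \<Longrightarrow> expr_eq Q A cs (App (pcomp Q q (length ts) r) (ts @ us @ ts'))
          (App q (ts @ App r us # ts'))"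
| expr_act: "wf_expr Q A cs (App q ts) \<Longrightarrow> \<sigma> permutes {..<length ts}
    \<Longrightarrow> expr_eq Q A cs (App (act Q q \<sigma>) (permute_list \<sigma> ts)) (App q ts)"
| expr_eval: "evaluable Q A q as \<Longrightarrow> expr_eq Q A cs (App q (map Elem as)) (Elem (eval A q as))"

definition expr_class ::
  "('c, 'q) operad \<Rightarrow> ('c, 'q, 'a) algebra \<Rightarrow> 'c list \<Rightarrow> ('q, 'a) expr \<Rightarrow> ('q, 'a) expr set" where
  "expr_class Q A cs t = {u. expr_eq Q A cs t u}"

definition rep :: "('q, 'a) expr set \<Rightarrow> ('q, 'a) expr" where
  "rep E = (SOME t. t \<in> E)"

definition free_coproduct :: "('c, 'q) operad \<Rightarrow> ('c, 'q, 'a) algebra \<Rightarrow> 'c list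
    \<Rightarrow> ('c, 'q, ('q, 'a) expr set) algebra" where
  "free_coproduct Q A cs =
     \<lparr> carrier = expr_class Q A cs ` {t. wf_expr Q A cs t},
       col = (\<lambda>E. expr_col Q A cs (rep E)),
       eval = (\<lambda>q Es. expr_class Q A cs (App q (map rep Es))) \<rparr>"

text \<open>The multiset of (indices of) variables occurring in an expression or element.\<close>

fun expr_vars :: "('q, 'a) expr \<Rightarrow> nat multiset" where
  "expr_vars (Var j) = {#j#}"
| "expr_vars (Elem a) = {#}"
| "expr_vars (App q ts) = (\<Sum>t\<leftarrow>ts. expr_vars t)"

definition vars :: "('q, 'a) expr set \<Rightarrow> nat multiset" where
  "vars E = expr_vars (rep E)"

definition multilinear ::
  "('c, 'q) operad \<Rightarrow> ('c, 'q, 'a) algebra \<Rightarrow> 'c list \<Rightarrow> ('q, 'a) expr set set" where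
  "multilinear Q A cs =
     {E \<in> carrier (free_coproduct Q A cs). \<forall>i<length cs. count (vars E) i = 1}"

text \<open>The value of an expression in \<open>B\<close>, with \<open>x\<^sub>i \<mapsto> bs ! i\<close> and \<open>a \<mapsto> g a\<close> for \<open>a \<in> A\<close>.\<close>

fun expr_value ::
  "('c, 'q, 'b) algebra \<Rightarrow> ('a \<Rightarrow> 'b) \<Rightarrow> 'b list \<Rightarrow> ('q, 'a) expr \<Rightarrow> 'b" where
  "expr_value B g bs (Var j) = bs ! j"
| "expr_value B g bs (Elem a) = g a"
| "expr_value B g bs (App q ts) = eval B q (map (expr_value B g bs) ts)"

definition elem_value ::
  "('c, 'q, 'b) algebra \<Rightarrow> ('a \<Rightarrow> 'b) \<Rightarrow> 'b list \<Rightarrow> ('q, 'a) expr set \<Rightarrow> 'b" where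
  "elem_value B g bs E = expr_value B g bs (rep E)"

fun expr_subst :: "(nat \<Rightarrow> ('q, 'a) expr) \<Rightarrow> ('q, 'a) expr \<Rightarrow> ('q, 'a) expr" where
  "expr_subst s (Var j) = s j"
| "expr_subst s (Elem a) = Elem a"
| "expr_subst s (App q ts) = App q (map (expr_subst s) ts)"

text \<open>
  Substitution of an element \<open>G\<close> with \<open>m\<close> variables for \<open>x\<^sub>i\<close>: the variables of \<open>G\<close> become
  \<open>x\<^sub>i,\<dots>,x\<^bsub>i+m-1\<^esub>\<close>, and \<open>x\<^sub>j\<close> with \<open>j > i\<close> becomes \<open>x\<^bsub>j+m-1\<^esub>\<close>. The colours of the variables
  of the result are \<open>cs\<close>.
\<close>

definition subst_at :: "('c, 'q) operad \<Rightarrow> ('c, 'q, 'a) algebra \<Rightarrow> 'c list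
    \<Rightarrow> ('q, 'a) expr set \<Rightarrow> nat \<Rightarrow> nat \<Rightarrow> ('q, 'a) expr set \<Rightarrow> ('q, 'a) expr set" where
  "subst_at Q A cs E i m G =
     expr_class Q A cs
       (expr_subst
         (\<lambda>j. if j < i then Var j
              else if j = i then expr_subst (\<lambda>l. Var (i + l)) (rep G)
              else Var (j + m - 1))
         (rep E))"

text \<open>
  Reordering of the variables: the new variables are \<open>y\<^sub>k = x\<^bsub>\<sigma> k\<^esub>\<close>, of colours \<open>cs\<close>.
\<close>

definition reorder :: "('c, 'q) operad \<Rightarrow> ('c, 'q, 'a) algebra \<Rightarrow> 'c list
    \<Rightarrow> ('q, 'a) expr set \<Rightarrow> (nat \<Rightarrow> nat) \<Rightarrow> ('q, 'a) expr set" where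
  "reorder Q A cs E \<sigma> = expr_class Q A cs (expr_subst (\<lambda>j. Var (inv \<sigma> j)) (rep E))"


subsection \<open>The universal property\<close>

text \<open>
  \<open>free_coproduct Q A cs\<close> is a \<open>Q\<close>-algebra, it receives a map from \<open>A\<close>, and a map out of it is
  determined by a map out of \<open>A\<close> and a choice of values of the variables: see
  \<open>free_coproduct_algebra\<close>, \<open>free_coproduct_inclusion\<close> and \<open>free_coproduct_universal\<close>.
\<close>

lemma map_eqI:
  "map f ts = cs \<Longrightarrow> (\<And>t. t \<in> set ts \<Longrightarrow> g t = f t) \<Longrightarrow> map g ts = cs"
  by (metis map_eq_conv)

locale operad_with_algebra = operad Q + operad_algebra Q A
  for Q :: "('c, 'q) operad" and A :: "('c, 'q, 'a) algebra"
begin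

lemma expr_col_closed:
  assumes "set cs \<subseteq> colours Q" "wf_expr Q A cs t"
  shows "expr_col Q A cs t \<in> colours Q"
  using assms by (cases t) (auto simp: col_closed result_closed dest: nth_mem)

lemma wf_pcomp:
  assumes "wf_expr Q A cs (App q (ts @ App r us # ts'))"
  shows "wf_expr Q A cs (App (pcomp Q q (length ts) r) (ts @ us @ ts'))"
    and "composable Q q (length ts) r"
proof -
  have m: "map (expr_col Q A cs) ts @ result Q r # map (expr_col Q A cs) ts' = inputs Q q"
    using assms by simp
  have n: "inputs Q q ! length ts = result Q r" unfolding m[symmetric]
    by (metis length_map nth_append_length)
  have l: "length ts < length (inputs Q q)" unfolding m[symmetric] by simp
  show c: "composable Q q (length ts) r"
    using assms n l by (simp add: composable_def)
  show "wf_expr Q A cs (App (pcomp Q q (length ts) r) (ts @ us @ ts'))"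
    using assms pcomp_ops[OF c] inputs_pcomp[OF c]
    by (auto simp: insert_at_def m[symmetric])
qed

lemma wf_act:
  assumes "wf_expr Q A cs (App q ts)" "\<sigma> permutes {..<length ts}"
  shows "wf_expr Q A cs (App (act Q q \<sigma>) (permute_list \<sigma> ts))"
    and "\<sigma> permutes {..<length (inputs Q q)}"
proof -
  have l: "length (inputs Q q) = length ts" using assms(1) by (metis length_map wf_expr.simps(3))
  show p: "\<sigma> permutes {..<length (inputs Q q)}" using assms(2) l by simp
  show "wf_expr Q A cs (App (act Q q \<sigma>) (permute_list \<sigma> ts))"
    using assms act_ops[OF _ p] inputs_act[OF _ p] 
    by (auto simp: permute_list_map[symmetric])
qed

lemma expr_eq_wf_col:
  assumes "set cs \<subseteq> colours Q" "expr_eq Q A cs t u"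
  shows "wf_expr Q A cs t \<and> wf_expr Q A cs u \<and> expr_col Q A cs t = expr_col Q A cs u"
  using assms(2)
proof (induction)
  case (expr_cong q ts us)
  then have "map (expr_col Q A cs) us = map (expr_col Q A cs) ts"
    by (auto simp: list_all2_conv_all_nth simp del: wf_expr.simps intro!: nth_equalityI)
  moreover have "\<forall>u\<in>set us. wf_expr Q A cs u"
    using expr_cong(2) by (auto simp: list_all2_conv_all_nth in_set_conv_nth)
  ultimately show ?case using expr_cong by simp
next
  case (expr_unit t)
  have "expr_col Q A cs t \<in> colours Q" using assms expr_unit expr_col_closed by blast
  then show ?case using expr_unit by (simp add: unit_ops inputs_unit result_unit)
next
  case (expr_pcomp q ts r us ts')
  then show ?case using wf_pcomp[OF expr_pcomp] by (simp add: result_pcomp)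
next
  case (expr_act q ts \<sigma>)
  then show ?case using wf_act[OF expr_act] by (auto simp: result_act)
next
  case (expr_eval q as)
  then have "\<forall>a\<in>set as. a \<in> carrier A" "map (col A) as = inputs Q q" "q \<in> ops Q" by (auto simp: evaluable_def)
  then show ?case using eval_closed[OF expr_eval] col_eval[OF expr_eval] by (auto simp: comp_def)
qed auto

lemma expr_eq_class: "expr_eq Q A cs t u \<Longrightarrow> expr_class Q A cs t = expr_class Q A cs u"
  by (auto simp: expr_class_def intro: expr_sym expr_trans)

lemma rep_class: "wf_expr Q A cs t \<Longrightarrow> expr_eq Q A cs t (rep (expr_class Q A cs t))"
  unfolding rep_def expr_class_def
  by (rule someI2[of _ t]) (auto intro: expr_refl)

lemma class_rep: "wf_expr Q A cs t \<Longrightarrow> expr_class Q A cs (rep (expr_class Q A cs t)) = expr_class Q A cs t"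
  using expr_eq_class rep_class by metis

lemma value_wf:
  assumes "operad_algebra Q B" "g \<in> algebra_hom Q A B" "set bs \<subseteq> carrier B"
    and t: "wf_expr Q A (map (col B) bs) t"
  shows "expr_value B g bs t \<in> carrier B \<and> col B (expr_value B g bs t) = expr_col Q A (map (col B) bs) t"
  using t
proof (induction t)
  case (Var x)
  then show ?case using assms by auto
next
  case (Elem a)
  then show ?case using assms by (auto simp: algebra_hom_def)
next
  case (App q ts)
  have "col B (expr_value B g bs t) = expr_col Q A (map (col B) bs) t" if "t \<in> set ts" for t using App that by simp
  then have "map (col B) (map (expr_value B g bs) ts) = inputs Q q" using App(2) by (auto intro: map_eqI)
  then have "evaluable Q B q (map (expr_value B g bs) ts)" using App by (auto simp: evaluable_def)
  then show ?case using operad_algebra.eval_closed[OF assms(1)] operad_algebra.col_eval[OF assms(1)] by simp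
qed

lemma value_evaluable:
  assumes "operad_algebra Q B" "g \<in> algebra_hom Q A B" "set bs \<subseteq> carrier B"
    and t: "wf_expr Q A (map (col B) bs) (App q ts)"
  shows "evaluable Q B q (map (expr_value B g bs) ts)"
proof -
  have "map (col B) (map (expr_value B g bs) ts) = inputs Q q"
    using value_wf[OF assms(1-3)] t by (auto intro: map_eqI)
  then show ?thesis using t value_wf[OF assms(1-3)] by (auto simp: evaluable_def)
qed

lemma value_eq:
  assumes B: "operad_algebra Q B" and g: "g \<in> algebra_hom Q A B" and bs: "set bs \<subseteq> carrier B"
    and t: "expr_eq Q A (map (col B) bs) t u"
  shows "expr_value B g bs t = expr_value B g bs u"
proof -
  note W = value_wf[OF B g bs] value_evaluable[OF B g bs]
  show ?thesis using t
  proof (induction)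
    case (expr_cong q ts us)
    then have "map (expr_value B g bs) ts = map (expr_value B g bs) us"
      by (auto simp: list_all2_conv_all_nth intro!: nth_equalityI)
    then show ?case by simp
  next
    case (expr_unit t)
    then show ?case using W(1)[OF expr_unit] operad_algebra.eval_unit[OF B, of "expr_value B g bs t"] by simp
  next
    case (expr_pcomp q ts r us ts')
    from W(2)[OF expr_pcomp] have 1: "evaluable Q B q (map (expr_value B g bs) ts @ eval B r (map (expr_value B g bs) us) # map (expr_value B g bs) ts')"
      by simp
    have 2: "evaluable Q B r (map (expr_value B g bs) us)" using W(2) expr_pcomp by auto
    show ?case using operad_algebra.eval_pcomp[OF B 2 1] by simp
  next
    case (expr_act q ts \<sigma>)
    then show ?case using operad_algebra.eval_act[OF B W(2)[OF expr_act(1)], of \<sigma>] by (simp add: permute_list_map)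
  next
    case (expr_eval q as)
    then show ?case using g by (auto simp: algebra_hom_def comp_def)
  qed auto
qed

lemma free_coproduct_carrier_rep:
  assumes "set cs \<subseteq> colours Q" "E \<in> carrier (free_coproduct Q A cs)"
  shows "wf_expr Q A cs (rep E)" "expr_class Q A cs (rep E) = E"
proof -
  obtain t where t: "E = expr_class Q A cs t" "wf_expr Q A cs t" using assms(2) by (auto simp: free_coproduct_def)
  show "wf_expr Q A cs (rep E)" using rep_class[OF t(2)] expr_eq_wf_col[OF assms(1)] t(1) by metis
  show "expr_class Q A cs (rep E) = E" using class_rep[OF t(2)] t(1) by simp
qed

lemma free_coproduct_classI: "wf_expr Q A cs t \<Longrightarrow> expr_class Q A cs t \<in> carrier (free_coproduct Q A cs)"
  unfolding free_coproduct_def by auto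

lemma free_coproduct_col: "set cs \<subseteq> colours Q \<Longrightarrow> wf_expr Q A cs t \<Longrightarrow> col (free_coproduct Q A cs) (expr_class Q A cs t) = expr_col Q A cs t"
  using rep_class[of cs t] expr_eq_wf_col unfolding free_coproduct_def by fastforce

lemma free_coproduct_evaluable:
  assumes "set cs \<subseteq> colours Q" "evaluable Q (free_coproduct Q A cs) q Es"
  shows "wf_expr Q A cs (App q (map rep Es))"
  using assms free_coproduct_carrier_rep[OF assms(1)]
  by (auto simp: evaluable_def) (simp add: free_coproduct_def comp_def)

lemma free_coproduct_eval:
  assumes cs: "set cs \<subseteq> colours Q" and t: "wf_expr Q A cs (App q ts)"
  shows "eval (free_coproduct Q A cs) q (map (expr_class Q A cs) ts) = expr_class Q A cs (App q ts)"
proof -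
  have "list_all2 (expr_eq Q A cs) ts (map rep (map (expr_class Q A cs) ts))"
    using t rep_class by (auto simp: list_all2_map2 list_all2_same)
  from expr_cong[OF t this] show ?thesis
    by (simp add: free_coproduct_def expr_eq_class)
qed

lemma free_coproduct_algebra:
  assumes cs: "set cs \<subseteq> colours Q"
  shows "operad_algebra Q (free_coproduct Q A cs)" (is "operad_algebra Q ?F")
proof -
  let ?C = "expr_class Q A cs"
  note R = free_coproduct_carrier_rep[OF cs]
  note W = free_coproduct_evaluable[OF cs]
  have ev: "eval ?F q Es = ?C (App q (map rep Es))" for q Es by (simp add: free_coproduct_def)
  have mr: "map ?C (map rep Es) = Es" if "set Es \<subseteq> carrier ?F" for Es
    using that R by (auto intro!: map_idI)
  show ?thesis
  proof
    fix E assume "E \<in> carrier ?F"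
    then show "col ?F E \<in> colours Q"
      using R expr_col_closed[OF cs] by (simp add: free_coproduct_def)
  next
    fix q Es assume "evaluable Q ?F q Es"
    note w = W[OF this]
    show "eval ?F q Es \<in> carrier ?F" unfolding ev by (rule free_coproduct_classI[OF w])
    show "col ?F (eval ?F q Es) = result Q q" unfolding ev using free_coproduct_col[OF cs w] by simp
  next
    fix E assume "E \<in> carrier ?F"
    note R' = R[OF this]
    show "eval ?F (unit Q (col ?F E)) [E] = E"
      using expr_eq_class[OF expr_unit[OF R'(1)]] R'(2) by (simp add: free_coproduct_def)
  next
    fix r Gs q Es Es'
    assume 1: "evaluable Q ?F r Gs" and 2: "evaluable Q ?F q (Es @ eval ?F r Gs # Es')"
    note w1 = W[OF 1]
    have s: "set Es \<subseteq> carrier ?F" "set Gs \<subseteq> carrier ?F" "set Es' \<subseteq> carrier ?F"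
      using 1 2 by (auto simp: evaluable_def)
    have eqs: "Es @ eval ?F r Gs # Es' = map ?C (map rep Es @ App r (map rep Gs) # map rep Es')"
      using mr[OF s(1)] mr[OF s(3)] ev by simp
    have c: "map (col ?F) (map ?C ts) = map (expr_col Q A cs) ts" if "\<forall>t\<in>set ts. wf_expr Q A cs t" for ts
      using that free_coproduct_col[OF cs] by auto
    have wfs: "\<forall>t\<in>set (map rep Es @ App r (map rep Gs) # map rep Es'). wf_expr Q A cs t"
      using s R w1 by (auto simp del: wf_expr.simps)
    have w2: "wf_expr Q A cs (App q (map rep Es @ App r (map rep Gs) # map rep Es'))"
      using 2 wfs c[OF wfs] unfolding eqs evaluable_def by simp
    have "eval ?F q (Es @ eval ?F r Gs # Es') = ?C (App q (map rep Es @ App r (map rep Gs) # map rep Es'))"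
      unfolding eqs by (rule free_coproduct_eval[OF cs w2])
    also have "\<dots> = ?C (App (pcomp Q q (length Es) r) (map rep Es @ map rep Gs @ map rep Es'))"
      using expr_eq_class[OF expr_pcomp[OF w2]] by simp
    finally show "eval ?F (pcomp Q q (length Es) r) (Es @ Gs @ Es') = eval ?F q (Es @ eval ?F r Gs # Es')"
      by (simp add: ev)
  next
    fix q Es \<sigma> assume 1: "evaluable Q ?F q Es" and 2: "\<sigma> permutes {..<length Es}"
    show "eval ?F (act Q q \<sigma>) (permute_list \<sigma> Es) = eval ?F q Es"
      using expr_eq_class[OF expr_act[OF W[OF 1]], of \<sigma>] 2 by (simp add: ev permute_list_map)
  qed
qed

lemma free_coproduct_inclusion:
  assumes cs: "set cs \<subseteq> colours Q"
  shows "(\<lambda>a\<in>carrier A. expr_class Q A cs (Elem a)) \<in> algebra_hom Q A (free_coproduct Q A cs)"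
    (is "?\<iota> \<in> _")
proof -
  have "?\<iota> (eval A q as) = eval (free_coproduct Q A cs) q (map ?\<iota> as)" if e: "evaluable Q A q as" for q as
  proof -
    have "map (expr_col Q A cs) (map Elem as) = inputs Q q" using e by (simp add: evaluable_def comp_def)
    moreover have "\<forall>a\<in>set as. a \<in> carrier A" using e by (auto simp: evaluable_def)
    ultimately have w: "wf_expr Q A cs (App q (map Elem as))" using e by (simp add: evaluable_def)
    have "map ?\<iota> as = map (expr_class Q A cs) (map Elem as)"
      using \<open>\<forall>a\<in>set as. a \<in> carrier A\<close> by simp
    then have "eval (free_coproduct Q A cs) q (map ?\<iota> as) = expr_class Q A cs (App q (map Elem as))"
      using free_coproduct_eval[OF cs w] by (simp only:)
    also have "\<dots> = expr_class Q A cs (Elem (eval A q as))"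
      by (rule expr_eq_class[OF expr_eval[OF e]])
    finally show ?thesis using eval_closed[OF e] by simp
  qed
  then show ?thesis
    using free_coproduct_classI[of cs "Elem _"] free_coproduct_col[OF cs, of "Elem _"]
    by (auto simp: algebra_hom_def)
qed

lemma free_coproduct_universal:
  assumes cs: "set cs \<subseteq> colours Q" and B: "operad_algebra Q B" and g: "g \<in> algebra_hom Q A B"
    and bs: "set bs \<subseteq> carrier B" "map (col B) bs = cs"
  shows "\<exists>!h. h \<in> algebra_hom Q (free_coproduct Q A cs) B
     \<and> (\<forall>i<length cs. h (expr_class Q A cs (Var i)) = bs ! i)
     \<and> (\<forall>a\<in>carrier A. h (expr_class Q A cs (Elem a)) = g a)" (is "\<exists>!h. ?P h")
proof -
  let ?F = "free_coproduct Q A cs"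
  define h where "h = (\<lambda>E\<in>carrier ?F. elem_value B g bs E)"
  note V = value_eq[OF B g bs(1)]  value_wf[OF B g bs(1)]
  note R = free_coproduct_carrier_rep[OF cs]
  note W = free_coproduct_evaluable[OF cs]
  have hc: "h (expr_class Q A cs t) = expr_value B g bs t" if "wf_expr Q A cs t" for t
    using that free_coproduct_classI[OF that] V(1)[unfolded bs, OF rep_class[OF that]] by (simp add: h_def elem_value_def)
  have "?P h"
  proof (intro conjI ballI allI impI)
    have "h (eval ?F q Es) = eval B q (map h Es)" if e: "evaluable Q ?F q Es" for q Es
    proof -
      have "h (eval ?F q Es) = expr_value B g bs (App q (map rep Es))"
        using hc[OF W[OF e]] by (simp add: free_coproduct_def)
      moreover have "map (expr_value B g bs) (map rep Es) = map h Es"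
        using e by (auto simp: h_def elem_value_def evaluable_def)
      ultimately show ?thesis by (simp only: expr_value.simps)
    qed
    moreover have "h \<in> carrier ?F \<rightarrow>\<^sub>E carrier B" using V(2)[unfolded bs] R by (auto simp: h_def elem_value_def)
    moreover have "col B (h E) = col ?F E" if "E \<in> carrier ?F" for E
      using V(2)[unfolded bs] R that by (auto simp: h_def elem_value_def free_coproduct_def)
    ultimately show "h \<in> algebra_hom Q ?F B" by (auto simp: algebra_hom_def)
  qed (simp_all add: hc)
  moreover have "k = h" if k: "?P k" for k
  proof -
    have kc: "k (expr_class Q A cs t) = expr_value B g bs t" if "wf_expr Q A cs t" for t
      using that
    proof (induction t)
      case (App q ts)
      have e: "evaluable Q ?F q (map (expr_class Q A cs) ts)"
      proof -
        have "map (col ?F) (map (expr_class Q A cs) ts) = inputs Q q"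
          using App(2) free_coproduct_col[OF cs] by (auto intro: map_eqI)
        then show ?thesis using App free_coproduct_classI by (auto simp: evaluable_def)
      qed
      have "k (expr_class Q A cs (App q ts)) = eval B q (map k (map (expr_class Q A cs) ts))"
        using k e unfolding free_coproduct_eval[OF cs App(2), symmetric] algebra_hom_def by blast
      also have "map k (map (expr_class Q A cs) ts) = map (expr_value B g bs) ts" using App by auto
      finally show ?case by simp
    qed (use k in auto)
    have "k E = h E" for E
    proof (cases "E \<in> carrier ?F")
      case True
      then show ?thesis using kc hc R by metis
    next
      case False
      moreover have "k \<in> extensional (carrier ?F)" using k by (simp add: algebra_hom_def PiE_def)
      ultimately show ?thesis by (simp add: h_def extensional_def)
    qed
    then show "k = h" by auto
  qed
  ultimately show ?thesis by (intro ex1I[of ?P h])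
qed

end


section \<open>Enveloping operad, plus construction and twisted arrow operad\<close>

text \<open>
  Operations are tagged with the list of their input colours, which makes the sets of operations
  with different inputs disjoint. The output colour is determined by the operation.
\<close>

definition UOp :: "('c, 'q) operad \<Rightarrow> ('c, 'q, 'a) algebra
    \<Rightarrow> ('c, 'c list \<times> ('q, 'a) expr set) operad" where
  "UOp Q A =
     \<lparr> colours = colours Q,
       ops = {(cs, E). set cs \<subseteq> colours Q \<and> E \<in> multilinear Q A cs},
       inputs = (\<lambda>(cs, E). cs),
       result = (\<lambda>(cs, E). col (free_coproduct Q A cs) E),
       unit = (\<lambda>c. ([c], expr_class Q A [c] (Var 0))),
       pcomp = (\<lambda>(cs, E) i (ds, G). let es = insert_at cs i ds in
                  (es, subst_at Q A es E i (length ds) G)),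
       act = (\<lambda>(cs, E) \<sigma>. let es = permute_list \<sigma> cs in (es, reorder Q A es E \<sigma>)) \<rparr>"

text \<open>
  A multilinear element of \<open>F(x\<^sub>1,\<dots>,x\<^sub>m)\<close> is the same as an operation of \<open>Q\<close> with inputs of the
  colours of the \<open>x\<^sub>i\<close>.
\<close>

definition BD_plus :: "('c, 'q) operad \<Rightarrow> ('c, 'q, 'a) algebra \<Rightarrow> ('a, 'a list \<times> 'q) operad" where
  "BD_plus Q A =
     \<lparr> colours = carrier A,
       ops = {(as, q). evaluable Q A q as},
       inputs = (\<lambda>(as, q). as),
       result = (\<lambda>(as, q). eval A q as),
       unit = (\<lambda>a. ([a], unit Q (col A a))),
       pcomp = (\<lambda>(as, q) i (bs, r). (insert_at as i bs, pcomp Q q i r)),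
       act = (\<lambda>(as, q) \<sigma>. (permute_list \<sigma> as, act Q q \<sigma>)) \<rparr>"

definition TwOp :: "('c, 'q) operad \<Rightarrow> ('c, 'q, 'a) algebra
    \<Rightarrow> ('a, 'a list \<times> ('q, 'a) expr set) operad" where
  "TwOp Q A =
     \<lparr> colours = carrier A,
       ops = {(as, E). set as \<subseteq> carrier A \<and> E \<in> multilinear Q A (map (col A) as)},
       inputs = (\<lambda>(as, E). as),
       result = (\<lambda>(as, E). elem_value A (\<lambda>a. a) as E),
       unit = (\<lambda>a. ([a], expr_class Q A [col A a] (Var 0))),
       pcomp = (\<lambda>(as, E) i (bs, G). let es = insert_at as i bs in
                  (es, subst_at Q A (map (col A) es) E i (length bs) G)),
       act = (\<lambda>(as, E) \<sigma>. let es = permute_list \<sigma> as in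
                  (es, reorder Q A (map (col A) es) E \<sigma>)) \<rparr>"

text \<open>
  The \<open>(Q,A)\<^sup>+\<close>-algebra of a \<open>Q\<close>-algebra \<open>f : B \<rightarrow> A\<close> over \<open>A\<close> (its underlying sets are the
  fibres of \<open>f\<close>), and the \<open>UOp Q A\<close>-algebra of a \<open>Q\<close>-algebra \<open>g : A \<rightarrow> B\<close> under \<open>A\<close>.
\<close>

definition over_algebra :: "('c, 'q, 'b) algebra \<Rightarrow> ('b \<Rightarrow> 'a) \<Rightarrow> ('a, 'a list \<times> 'q, 'b) algebra" where
  "over_algebra B f = \<lparr> carrier = carrier B, col = f, eval = (\<lambda>(as, q). eval B q) \<rparr>"

definition under_algebra :: "('c, 'q, 'b) algebra \<Rightarrow> ('a \<Rightarrow> 'b)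
    \<Rightarrow> ('c, 'c list \<times> ('q, 'a) expr set, 'b) algebra" where
  "under_algebra B g =
     \<lparr> carrier = carrier B, col = col B, eval = (\<lambda>(cs, E) bs. elem_value B g bs E) \<rparr>"

abbreviation id_plus :: "('c, 'q, 'a) algebra \<Rightarrow> ('a, 'a list \<times> 'q, 'a) algebra" where
  "id_plus A \<equiv> over_algebra A (\<lambda>a. a)"

abbreviation id_UOp :: "('c, 'q, 'a) algebra
    \<Rightarrow> ('c, 'c list \<times> ('q, 'a) expr set, 'a) algebra" where
  "id_UOp A \<equiv> under_algebra A (\<lambda>a. a)"


section \<open>Categories and equivalences of categories\<close>

record ('o, 'm) category =
  Obj :: "'o set"
  Hom :: "'o \<Rightarrow> 'o \<Rightarrow> 'm set"
  Ident :: "'o \<Rightarrow> 'm"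
  Comp :: "'o \<Rightarrow> 'o \<Rightarrow> 'o \<Rightarrow> 'm \<Rightarrow> 'm \<Rightarrow> 'm"

text \<open>\<open>Comp C X Y Z g f\<close> is the composite of \<open>f : X \<rightarrow> Y\<close> and \<open>g : Y \<rightarrow> Z\<close>.\<close>

locale category =
  fixes C :: "('o, 'm) category"
  assumes Ident_Hom: "X \<in> Obj C \<Longrightarrow> Ident C X \<in> Hom C X X"
    and Comp_Hom: "\<lbrakk>X \<in> Obj C; Y \<in> Obj C; Z \<in> Obj C; f \<in> Hom C X Y; g \<in> Hom C Y Z\<rbrakk>
          \<Longrightarrow> Comp C X Y Z g f \<in> Hom C X Z"
    and Comp_Ident_right: "\<lbrakk>X \<in> Obj C; Y \<in> Obj C; f \<in> Hom C X Y\<rbrakk>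
          \<Longrightarrow> Comp C X X Y f (Ident C X) = f"
    and Comp_Ident_left: "\<lbrakk>X \<in> Obj C; Y \<in> Obj C; f \<in> Hom C X Y\<rbrakk>
          \<Longrightarrow> Comp C X Y Y (Ident C Y) f = f"
    and Comp_assoc: "\<lbrakk>W \<in> Obj C; X \<in> Obj C; Y \<in> Obj C; Z \<in> Obj C;
            f \<in> Hom C W X; g \<in> Hom C X Y; h \<in> Hom C Y Z\<rbrakk>
          \<Longrightarrow> Comp C W Y Z h (Comp C W X Y g f) = Comp C W X Z (Comp C X Y Z h g) f"

locale cat_functor = domain: category C + codomain: category D
  for C :: "('o, 'm) category" and D :: "('p, 'n) category" +
  fixes Fo :: "'o \<Rightarrow> 'p" and Fm :: "'o \<Rightarrow> 'o \<Rightarrow> 'm \<Rightarrow> 'n"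
  assumes Fo_Obj: "X \<in> Obj C \<Longrightarrow> Fo X \<in> Obj D"
    and Fm_Hom: "\<lbrakk>X \<in> Obj C; Y \<in> Obj C; f \<in> Hom C X Y\<rbrakk> \<Longrightarrow> Fm X Y f \<in> Hom D (Fo X) (Fo Y)"
    and Fm_Ident: "X \<in> Obj C \<Longrightarrow> Fm X X (Ident C X) = Ident D (Fo X)"
    and Fm_Comp: "\<lbrakk>X \<in> Obj C; Y \<in> Obj C; Z \<in> Obj C; f \<in> Hom C X Y; g \<in> Hom C Y Z\<rbrakk>
          \<Longrightarrow> Fm X Z (Comp C X Y Z g f) = Comp D (Fo X) (Fo Y) (Fo Z) (Fm Y Z g) (Fm X Y f)"

definition isomorphism :: "('o, 'm) category \<Rightarrow> 'o \<Rightarrow> 'o \<Rightarrow> 'm \<Rightarrow> bool" where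
  "isomorphism C X Y f \<longleftrightarrow> f \<in> Hom C X Y
     \<and> (\<exists>g\<in>Hom C Y X. Comp C X Y X g f = Ident C X \<and> Comp C Y X Y f g = Ident C Y)"

definition natural_iso :: "('o, 'm) category \<Rightarrow> ('p, 'n) category
    \<Rightarrow> ('o \<Rightarrow> 'p) \<Rightarrow> ('o \<Rightarrow> 'o \<Rightarrow> 'm \<Rightarrow> 'n) \<Rightarrow> ('o \<Rightarrow> 'p) \<Rightarrow> ('o \<Rightarrow> 'o \<Rightarrow> 'm \<Rightarrow> 'n)
    \<Rightarrow> ('o \<Rightarrow> 'n) \<Rightarrow> bool" where
  "natural_iso C D Fo Fm Go Gm \<eta> \<longleftrightarrow>
     (\<forall>X\<in>Obj C. isomorphism D (Fo X) (Go X) (\<eta> X))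
     \<and> (\<forall>X\<in>Obj C. \<forall>Y\<in>Obj C. \<forall>f\<in>Hom C X Y.
          Comp D (Fo X) (Fo Y) (Go Y) (\<eta> Y) (Fm X Y f)
          = Comp D (Fo X) (Go X) (Go Y) (Gm X Y f) (\<eta> X))"

definition equivalent_categories :: "('o, 'm) category \<Rightarrow> ('p, 'n) category \<Rightarrow> bool" where
  "equivalent_categories C D \<longleftrightarrow>
     (\<exists>Fo Fm Go Gm \<eta> \<epsilon>. cat_functor C D Fo Fm \<and> cat_functor D C Go Gm
        \<and> natural_iso C C (\<lambda>X. X) (\<lambda>X Y f. f)
            (\<lambda>X. Go (Fo X)) (\<lambda>X Y f. Gm (Fo X) (Fo Y) (Fm X Y f)) \<eta>
        \<and> natural_iso D D (\<lambda>X. Fo (Go X)) (\<lambda>X Y f. Fm (Go X) (Go Y) (Gm X Y f))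
            (\<lambda>X. X) (\<lambda>X Y f. f) \<epsilon>)"

text \<open>
  The categories below consist of the algebras whose elements are of the (arbitrary) type \<open>'b\<close>,
  which plays the role of the universe of sets.
\<close>

definition algebra_category ::
  "('c, 'q) operad \<Rightarrow> (('c, 'q, 'b) algebra, 'b \<Rightarrow> 'b) category" where
  "algebra_category Q =
     \<lparr> Obj = {B. operad_algebra Q B},
       Hom = algebra_hom Q,
       Ident = (\<lambda>B. \<lambda>b\<in>carrier B. b),
       Comp = (\<lambda>B B' B'' g f. compose (carrier B) g f) \<rparr>"

text \<open>\<open>Q\<close>-algebras \<open>B\<close> with maps \<open>f : B \<rightarrow> A\<close> and \<open>g : A \<rightarrow> B\<close> such that \<open>f \<circ> g = id\<close>.\<close>

definition over_under_category :: "('c, 'q) operad \<Rightarrow> ('c, 'q, 'a) algebra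
    \<Rightarrow> (('c, 'q, 'b) algebra \<times> ('b \<Rightarrow> 'a) \<times> ('a \<Rightarrow> 'b), 'b \<Rightarrow> 'b) category" where
  "over_under_category Q A =
     \<lparr> Obj = {(B, f, g). operad_algebra Q B \<and> f \<in> algebra_hom Q B A \<and> g \<in> algebra_hom Q A B
                \<and> (\<forall>a\<in>carrier A. f (g a) = a)},
       Hom = (\<lambda>(B, f, g) (B', f', g').
                {h \<in> algebra_hom Q B B'. (\<forall>b\<in>carrier B. f' (h b) = f b)
                   \<and> (\<forall>a\<in>carrier A. h (g a) = g' a)}),
       Ident = (\<lambda>(B, f, g). \<lambda>b\<in>carrier B. b),
       Comp = (\<lambda>(B, f, g) X Y h' h. compose (carrier B) h' h) \<rparr>"

end

theory Submission
  imports Defs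
begin

text \<open>
  Write an operation of \<open>TwOp\<^sub>Q(A)\<close> as a pair \<open>(as, [t])\<close>, where \<open>t\<close> is an expression in variables of
  the colours of \<open>as\<close> and in elements of \<open>A\<close>, and every variable occurs exactly once. Since the
  variables carry values in \<open>A\<close>, every subexpression of \<open>t\<close> has a value in \<open>A\<close> too.

  An operation of \<open>(Q,A)\<^sup>+\<close> is an operation of \<open>Q\<close> together with the list of its arguments in \<open>A\<close>.
  Hence an expression over \<open>(Q,A)\<^sup>+\<close> and \<open>id\<^sub>A\<close> is an expression over \<open>Q\<close> and \<open>A\<close> in which every
  node also records the values of its arguments. These values are determined by the values of the
  variables, so recording them (\<open>annotate\<close>) and forgetting them (\<open>erase\<close>) are mutually inverse.
  Both respect the congruence that defines the coproduct (\<open>expr_eq_annotate\<close>, \<open>expr_eq_erase\<close>), and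
  recording commutes with substitution (\<open>annotate_subst\<close>). This is the isomorphism of
  \<open>TwOp\<^sub>Q(A)\<close> with the enveloping operad of \<open>id\<^sub>A\<close> over \<open>(Q,A)\<^sup>+\<close> (\<open>TwOp_iso_UOp_plus\<close>). An operation of
  the plus construction of the enveloping operad is \<open>[t]\<close> together with arguments \<open>as\<close>, which is
  the definition of \<open>TwOp\<^sub>Q(A)\<close> up to the place where the colours of the variables are stored
  (\<open>TwOp_iso_plus_UOp\<close>).

  For algebras, a retract \<open>A \<rightarrow> B \<rightarrow> A\<close> gives a \<open>TwOp\<^sub>Q(A)\<close>-algebra with the same elements, coloured
  by the map to \<open>A\<close>, in which \<open>(as, [t])\<close> acts by evaluating \<open>t\<close> in \<open>B\<close>. Conversely, let \<open>X\<close> be a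
  \<open>TwOp\<^sub>Q(A)\<close>-algebra. An operation \<open>q\<close> of \<open>Q\<close> acts on \<open>X\<close> through \<open>[q(x\<^sub>0,\<dots>,x\<^bsub>n-1\<^esub>)]\<close>, and the nullary
  operation \<open>[a]\<close> gives the image of \<open>a \<in> A\<close> in \<open>X\<close>. The crux is that these data determine the whole
  action (\<open>apply_linear\<close>): a multilinear expression becomes, after a permutation of the variables,
  planar, that is, its variables occur in the order \<open>x\<^sub>0, x\<^sub>1, \<dots>\<close>; and a planar expression is an iterated
  operadic composite of operations \<open>q(x\<^sub>0,\<dots>,x\<^bsub>n-1\<^esub>)\<close>, elements of \<open>A\<close> and variables. It follows that
  \<open>a \<mapsto> [a]\<close> is a map of \<open>Q\<close>-algebras and that the two passages are mutually inverse, up to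
  the values that the records take outside of their carriers. Both passages are the identity on
  maps, which gives the equivalence of categories.
\<close>

section \<open>Substitution in expressions\<close>

fun var_list :: "('q, 'a) expr \<Rightarrow> nat list" where
  "var_list (Var j) = [j]"
| "var_list (Elem a) = []"
| "var_list (App q ts) = concat (map var_list ts)"

lemma mset_var_list: "mset (var_list t) = expr_vars t"
proof (induction t)
  case (App q ts)
  then have "map (mset \<circ> var_list) ts = map expr_vars ts" by simp
  then show ?case by (simp add: mset_concat del: map_eq_conv)
qed auto

lemma var_list_less: "wf_expr Q A cs t \<Longrightarrow> j \<in> set (var_list t) \<Longrightarrow> j < length cs"
  by (induction t) auto

lemma expr_subst_cong:
  "(\<And>j. j \<in> set (var_list t) \<Longrightarrow> s j = s' j) \<Longrightarrow> expr_subst s t = expr_subst s' t"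
  by (induction t) auto

lemma expr_subst_Var: "expr_subst Var t = t"
  by (induction t) (auto intro: map_idI)

lemma expr_subst_subst: "expr_subst s (expr_subst s' t) = expr_subst (\<lambda>j. expr_subst s (s' j)) t"
  by (induction t) auto

lemma expr_subst_id: "(\<And>j. j \<in> set (var_list t) \<Longrightarrow> s j = Var j) \<Longrightarrow> expr_subst s t = t"
  using expr_subst_cong[of t s Var] by (simp add: expr_subst_Var)

lemma var_list_rename: "var_list (expr_subst (\<lambda>j. Var (f j)) t) = map f (var_list t)"
  by (induction t) (auto simp: map_concat comp_def intro!: arg_cong[where f = concat])

lemma size_rename: "size (expr_subst (\<lambda>j. Var (f j)) t) = size t"
proof (induction t)
  case (App q ts)
  then have "map (size \<circ> expr_subst (\<lambda>j. Var (f j))) ts = map size ts" by simp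
  then show ?case by (simp add: size_list_conv_sum_list comp_def del: map_eq_conv)
qed auto

lemma expr_value_subst:
  "(\<And>j. j \<in> set (var_list t) \<Longrightarrow> expr_value B g bs (s j) = bs' ! j)
    \<Longrightarrow> expr_value B g bs (expr_subst s t) = expr_value B g bs' t"
  by (induction t) (fastforce intro!: arg_cong[where f = "eval B _"])+

lemma expr_value_cong:
  "(\<And>j. j \<in> set (var_list t) \<Longrightarrow> bs ! j = bs' ! j)
    \<Longrightarrow> expr_value B g bs t = expr_value B g bs' t"
  by (induction t) (fastforce intro!: arg_cong[where f = "eval B _"])+

definition wf_subst :: "('c, 'q) operad \<Rightarrow> ('c, 'q, 'a) algebra \<Rightarrow> 'c list \<Rightarrow> 'c list
    \<Rightarrow> (nat \<Rightarrow> ('q, 'a) expr) \<Rightarrow> bool" where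
  "wf_subst Q A cs es s \<longleftrightarrow>
     (\<forall>j<length cs. wf_expr Q A es (s j) \<and> expr_col Q A es (s j) = cs ! j)"

text \<open>
  The conditions concern only the variables that occur: below, expressions are moved between
  different lists of variables, of which they use only a part.
\<close>

lemma wf_expr_subst:
  assumes "\<And>j. j \<in> set (var_list t) \<Longrightarrow> wf_expr Q A es (s j) \<and> expr_col Q A es (s j) = cs ! j"
    and "wf_expr Q A cs t"
  shows "wf_expr Q A es (expr_subst s t) \<and> expr_col Q A es (expr_subst s t) = expr_col Q A cs t"
  using assms
proof (induction t)
  case (App q ts)
  have "wf_expr Q A es (expr_subst s t) \<and> expr_col Q A es (expr_subst s t) = expr_col Q A cs t"
    if "t \<in> set ts" for t
    using App that by fastforce
  then show ?case using App(3) by (auto intro: map_eqI)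
qed auto

lemma wf_substD:
  "wf_subst Q A cs es s \<Longrightarrow> wf_expr Q A cs t
    \<Longrightarrow> wf_expr Q A es (expr_subst s t) \<and> expr_col Q A es (expr_subst s t) = expr_col Q A cs t"
  by (rule wf_expr_subst) (auto simp: wf_subst_def dest: var_list_less)

text \<open>
  The congruence is generated by schemes that are stable under substitution, so substitution acts
  on the elements of the coproduct.
\<close>

lemma expr_eq_subst:
  assumes s: "wf_subst Q A cs es s" and "expr_eq Q A cs t u"
  shows "expr_eq Q A es (expr_subst s t) (expr_subst s u)"
  using assms(2)
proof (induction)
  case (expr_refl t)
  then show ?case using wf_substD[OF s] by (blast intro: expr_eq.expr_refl)
next
  case (expr_cong q ts us)
  then show ?case using wf_substD[OF s expr_cong(1)]
    by (auto intro!: expr_eq.expr_cong simp: list_all2_conv_all_nth)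
next
  case (expr_unit t)
  then show ?case using wf_substD[OF s expr_unit] expr_eq.expr_unit[of Q A es "expr_subst s t"] by auto
next
  case (expr_pcomp q ts r us ts')
  then show ?case using wf_substD[OF s expr_pcomp]
      expr_eq.expr_pcomp[of Q A es q "map (expr_subst s) ts" r "map (expr_subst s) us" "map (expr_subst s) ts'"]
    by auto
next
  case (expr_act q ts \<sigma>)
  then show ?case using wf_substD[OF s expr_act(1)]
      expr_eq.expr_act[of Q A es q "map (expr_subst s) ts" \<sigma>]
    by (auto simp: permute_list_map)
next
  case (expr_eval q as)
  then show ?case using expr_eq.expr_eval[OF expr_eval, of es] by (simp add: comp_def)
qed (auto intro: expr_eq.expr_sym expr_eq.expr_trans)

lemma expr_eq_subst_pointwise:
  assumes s: "wf_subst Q A cs es s" and "wf_expr Q A cs t"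
    and "\<And>j. j < length cs \<Longrightarrow> expr_eq Q A es (s j) (s' j)"
  shows "expr_eq Q A es (expr_subst s t) (expr_subst s' t)"
  using assms(2)
proof (induction t)
  case (App q ts)
  then show ?case using wf_substD[OF s App(2)]
    by (auto intro!: expr_cong simp: list_all2_conv_all_nth)
qed (auto intro: expr_refl assms(3))

text \<open>
  Each generating relation keeps the multiset of variables, at most permuting arguments. Hence
  multilinearity can be read off from any representative of an element.
\<close>

lemma expr_vars_expr_eq: "expr_eq Q A cs t u \<Longrightarrow> expr_vars t = expr_vars u"
proof (induction rule: expr_eq.induct)
  case (expr_cong q ts us)
  then have "map expr_vars ts = map expr_vars us"
    by (auto simp: list_all2_conv_all_nth intro!: nth_equalityI)
  then show ?case by simp
next
  case (expr_act q ts \<sigma>)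
  then have "sum_mset (mset (map expr_vars (permute_list \<sigma> ts))) = sum_mset (mset (map expr_vars ts))"
    by simp
  then show ?case unfolding sum_mset_sum_list by simp
qed (auto simp: comp_def)

text \<open>
  The substitution that underlies partial composition at \<open>x\<^sub>i\<close>: \<open>u\<close>, with \<open>m\<close> variables, is put in
  place of \<open>x\<^sub>i\<close>.
\<close>

definition graft_subst :: "nat \<Rightarrow> nat \<Rightarrow> ('q, 'a) expr \<Rightarrow> nat \<Rightarrow> ('q, 'a) expr" where
  "graft_subst i m u j = (if j < i then Var j
              else if j = i then expr_subst (\<lambda>l. Var (i + l)) u
              else Var (j + m - 1))"

lemma nth_insert_at:
  assumes "i < length xs"
  shows "j < i \<Longrightarrow> insert_at xs i ys ! j = xs ! j"
    and "l < length ys \<Longrightarrow> insert_at xs i ys ! (i + l) = ys ! l"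
    and "i < j \<Longrightarrow> j < length xs \<Longrightarrow> insert_at xs i ys ! (j + length ys - 1) = xs ! j"
    and "length (insert_at xs i ys) = length xs + length ys - 1"
  using assms by (auto simp: insert_at_def nth_append min_def)

lemma insert_at_split: "insert_at (xs @ x # zs) (length xs) ys = xs @ ys @ zs"
  by (simp add: insert_at_def)

lemma split_at: "i < length xs \<Longrightarrow> \<exists>as bs. xs = as @ xs ! i # bs \<and> length as = i"
  by (metis id_take_nth_drop length_take less_imp_le_nat min_absorb2)

text \<open>
  The list parts of the operad axioms for the plus construction, whose operations carry the lists
  of their arguments.
\<close>

lemma insert_at_sequential:
  assumes "i < length xs" "j < length ys"
  shows "insert_at (insert_at xs i ys) (i + j) zs = insert_at xs i (insert_at ys j zs)"
proof -
  obtain as x bs where x: "xs = as @ x # bs" "length as = i" using split_at[OF assms(1)] by metis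
  obtain cs y ds where y: "ys = cs @ y # ds" "length cs = j" using split_at[OF assms(2)] by metis
  show ?thesis using insert_at_split[of "as @ cs" y "ds @ bs" zs]
    by (simp add: x(1) y(1) x(2)[symmetric] y(2)[symmetric] insert_at_split)
qed

lemma insert_at_parallel:
  assumes "i < k" "k < length xs"
  shows "insert_at (insert_at xs i ys) (k + length ys - 1) zs = insert_at (insert_at xs k zs) i ys"
proof -
  obtain as x ws where x: "xs = as @ x # ws" "length as = i" using split_at[of i xs] assms by auto
  have "k - Suc i < length ws" using assms x by auto
  then obtain cs y ds where y: "ws = cs @ y # ds" "length cs = k - Suc i" using split_at by metis
  have k: "k = Suc (length as + length cs)" using x y assms by simp
  show ?thesis
    using insert_at_split[of "as @ ys @ cs" y ds zs] insert_at_split[of "as @ x # cs" y ds zs]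
    by (simp add: x(1) x(2)[symmetric] y(1) insert_at_split k algebra_simps)
qed

lemma insert_at_unit: "insert_at [x] 0 ys = ys" "i < length xs \<Longrightarrow> insert_at xs i [xs ! i] = xs"
  by (simp_all add: insert_at_def id_take_nth_drop[symmetric])

lemma insert_at_permute:
  assumes \<sigma>: "\<sigma> permutes {..<length xs}" and i: "i < length xs"
    and \<tau>: "\<tau> permutes {..<length ys}"
  shows "insert_at (permute_list \<sigma> xs) i (permute_list \<tau> ys)
    = permute_list (perm_pcomp \<sigma> i (length ys) \<tau>) (insert_at xs (\<sigma> i) ys)"
proof (rule nth_equalityI)
  let ?m = "length ys" and ?n = "length xs"
  have si: "\<sigma> i < ?n" using permutes_in_image[OF \<sigma>] i by auto
  note L = nth_insert_at[where xs = "permute_list \<sigma> xs" and ys = "permute_list \<tau> ys"]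
  note R = nth_insert_at[OF si, where ys = ys]
  show len: "length (insert_at (permute_list \<sigma> xs) i (permute_list \<tau> ys))
      = length (permute_list (perm_pcomp \<sigma> i ?m \<tau>) (insert_at xs (\<sigma> i) ys))"
    using L R i by simp
  fix p assume "p < length (insert_at (permute_list \<sigma> xs) i (permute_list \<tau> ys))"
  then have p: "p < ?n + ?m - 1" using L i by simp
  have right: "permute_list (perm_pcomp \<sigma> i ?m \<tau>) (insert_at xs (\<sigma> i) ys) ! p
      = insert_at xs (\<sigma> i) ys ! perm_pcomp \<sigma> i ?m \<tau> p"
    using p R by (simp add: permute_list_def)
  have shift: "insert_at xs (\<sigma> i) ys ! (if j < \<sigma> i then j else j + ?m - 1) = xs ! j"
    if "j < ?n" "j \<noteq> \<sigma> i" for j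
    using that R by auto
  consider "p < i" | "i \<le> p" "p < i + ?m" | "i + ?m \<le> p" by linarith
  then show "insert_at (permute_list \<sigma> xs) i (permute_list \<tau> ys) ! p
      = permute_list (perm_pcomp \<sigma> i ?m \<tau>) (insert_at xs (\<sigma> i) ys) ! p"
  proof cases
    case 1
    then have "\<sigma> p < ?n" "\<sigma> p \<noteq> \<sigma> i"
      using permutes_in_image[OF \<sigma>, of p] permutes_inj[OF \<sigma>] i by (auto simp: inj_def)
    then show ?thesis unfolding right using 1 i L(1) shift
      by (simp add: perm_pcomp_def permute_list_nth[OF \<sigma>])
  next
    case 2
    then have "p = i + (p - i)" "p - i < ?m" by auto
    moreover have "\<tau> (p - i) < ?m" using permutes_in_image[OF \<tau>, of "p - i"] \<open>p - i < ?m\<close> by simp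
    ultimately show ?thesis unfolding right using 2 i L(2)[of i "p - i"] R(2)
      by (simp add: perm_pcomp_def permute_list_nth[OF \<tau>])
  next
    case 3
    define q where "q = p + 1 - ?m"
    have q: "i < q" "q < ?n" "p = q + ?m - 1" using 3 p by (auto simp: q_def)
    then have "\<sigma> q < ?n" "\<sigma> q \<noteq> \<sigma> i"
      using permutes_in_image[OF \<sigma>, of q] permutes_inj[OF \<sigma>] by (auto simp: inj_def)
    then have "insert_at xs (\<sigma> i) ys ! perm_pcomp \<sigma> i ?m \<tau> p = xs ! \<sigma> q"
      using 3 q shift[of "\<sigma> q"] by (simp add: perm_pcomp_def q_def[symmetric] Let_def)
    moreover have "insert_at (permute_list \<sigma> xs) i (permute_list \<tau> ys) ! p = xs ! \<sigma> q"
      using L(3)[of i q] q i by (simp add: permute_list_nth[OF \<sigma>])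
    ultimately show ?thesis unfolding right by simp
  qed
qed
lemma map_insert_at: "map f (insert_at xs i ys) = insert_at (map f xs) i (map f ys)"
  by (simp add: insert_at_def take_map drop_map)

section \<open>Composition on representatives\<close>

lemma wf_graft:
  assumes i: "i < length cs" and u: "wf_expr Q A ds u" "expr_col Q A ds u = cs ! i"
  shows "wf_subst Q A cs (insert_at cs i ds) (graft_subst i (length ds) u)"
proof -
  let ?es = "insert_at cs i ds"
  note N = nth_insert_at[OF i]
  have "wf_expr Q A ?es (expr_subst (\<lambda>l. Var (i + l)) u)
    \<and> expr_col Q A ?es (expr_subst (\<lambda>l. Var (i + l)) u) = expr_col Q A ds u"
  proof (rule wf_substD[OF _ u(1)])
    show "wf_subst Q A ds ?es (\<lambda>l. Var (i + l))"
      using i N(2)[of _ ds] N(4)[of ds] by (auto simp: wf_subst_def)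
  qed
  then show ?thesis
    using i u N(1)[of _ ds] N(3)[of _ ds] N(4)[of ds] by (auto simp: wf_subst_def graft_subst_def)
qed

lemma value_graft_subst:
  assumes "i < length bs" "wf_expr Q A ds u" "length ds = length bs'" "j < length bs"
  shows "expr_value B g (insert_at bs i bs') (graft_subst i (length bs') u j)
     = bs[i := expr_value B g bs' u] ! j"
proof -
  note N = nth_insert_at[OF assms(1)]
  have "expr_value B g (insert_at bs i bs') (expr_subst (\<lambda>l. Var (i + l)) u) = expr_value B g bs' u"
    using N(2)[of _ bs'] var_list_less[OF assms(2)] assms(3) by (intro expr_value_subst) auto
  then show ?thesis using assms N(1)[of _ bs'] N(3)[of _ bs'] by (auto simp: graft_subst_def)
qed

lemma value_graft:
  assumes i: "i < length bs" and t: "wf_expr Q A cs t" "length cs = length bs"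
    and u: "wf_expr Q A ds u" "length ds = length bs'"
  shows "expr_value B g (insert_at bs i bs') (expr_subst (graft_subst i (length bs') u) t)
     = expr_value B g (bs[i := expr_value B g bs' u]) t"
  using value_graft_subst[OF i u] var_list_less[OF t(1)] t(2) by (intro expr_value_subst) auto

lemma wf_reorder:
  assumes "\<sigma> permutes {..<length cs}"
  shows "wf_subst Q A cs (permute_list \<sigma> cs) (\<lambda>j. Var (inv \<sigma> j))"
  using permutes_in_image[OF permutes_inv[OF assms]]
  by (auto simp: wf_subst_def permute_list_nth[OF assms] permutes_inverses[OF assms])

lemma nth_permute_list_inv:
  assumes "\<sigma> permutes {..<length bs}" "j < length bs"
  shows "permute_list \<sigma> bs ! inv \<sigma> j = bs ! j"
  using permutes_in_image[OF permutes_inv[OF assms(1)], of j] assms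
  by (auto simp: permute_list_nth[OF assms(1)] permutes_inverses[OF assms(1)])

lemma value_reorder:
  assumes \<sigma>: "\<sigma> permutes {..<length bs}" and t: "wf_expr Q A cs t" "length cs = length bs"
  shows "expr_value B g (permute_list \<sigma> bs) (expr_subst (\<lambda>j. Var (inv \<sigma> j)) t) = expr_value B g bs t"
  using nth_permute_list_inv[OF \<sigma>] var_list_less[OF t(1)] t(2) by (intro expr_value_subst) auto

context operad_algebra
begin

lemma id_hom: "restrict (\<lambda>a. a) (carrier A) \<in> algebra_hom Q A A"
proof -
  have "map (restrict (\<lambda>a. a) (carrier A)) as = as" if "set as \<subseteq> carrier A" for as
    using that by (intro map_idI) auto
  then show ?thesis using eval_closed by (auto simp: algebra_hom_def evaluable_def)
qed

end

context operad_with_algebra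
begin

lemma expr_eq_wf:
  "set cs \<subseteq> colours Q \<Longrightarrow> expr_eq Q A cs t u \<Longrightarrow> wf_expr Q A cs u"
  "set cs \<subseteq> colours Q \<Longrightarrow> expr_eq Q A cs t u \<Longrightarrow> expr_col Q A cs u = expr_col Q A cs t"
  by (simp_all add: expr_eq_wf_col)

lemma multilinear_rep:
  assumes "set cs \<subseteq> colours Q" "E \<in> multilinear Q A cs"
  shows "wf_expr Q A cs (rep E)" "expr_class Q A cs (rep E) = E"
    "\<And>i. i < length cs \<Longrightarrow> count (expr_vars (rep E)) i = 1"
  using assms free_coproduct_carrier_rep[OF assms(1)] by (auto simp: multilinear_def vars_def)

lemma expr_vars_rep: "wf_expr Q A cs t \<Longrightarrow> expr_vars (rep (expr_class Q A cs t)) = expr_vars t"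
  using expr_vars_expr_eq[OF rep_class] by metis

lemma multilinear_class:
  assumes "wf_expr Q A cs t" "\<And>i. i < length cs \<Longrightarrow> count (expr_vars t) i = 1"
  shows "expr_class Q A cs t \<in> multilinear Q A cs"
  using assms free_coproduct_classI by (auto simp: multilinear_def vars_def expr_vars_rep)

text \<open>
  Composition and the symmetric group actions are defined through chosen representatives. These
  two lemmas allow any representative instead.
\<close>

lemma subst_at_class:
  assumes cs: "set cs \<subseteq> colours Q" and ds: "set ds \<subseteq> colours Q" and i: "i < length cs"
    and t: "wf_expr Q A cs t" and u: "wf_expr Q A ds u" "expr_col Q A ds u = cs ! i"
    and m: "m = length ds"
  shows "subst_at Q A (insert_at cs i ds) (expr_class Q A cs t) i m (expr_class Q A ds u)
    = expr_class Q A (insert_at cs i ds) (expr_subst (graft_subst i (length ds) u) t)"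
proof -
  let ?es = "insert_at cs i ds" and ?t = "rep (expr_class Q A cs t)" and ?u = "rep (expr_class Q A ds u)"
  note T = rep_class[OF t] and U = rep_class[OF u(1)]
  have "expr_eq Q A ?es (graft_subst i (length ds) u j) (graft_subst i (length ds) ?u j)"
    if "j < length cs" for j
  proof (cases "j = i")
    case True
    have "wf_subst Q A ds ?es (\<lambda>l. Var (i + l))"
      using i nth_insert_at[OF i] by (auto simp: wf_subst_def)
    then show ?thesis using True expr_eq_subst[OF _ U] by (simp add: graft_subst_def)
  next
    case False
    have "graft_subst i (length ds) ?u j = graft_subst i (length ds) u j"
      using False by (simp add: graft_subst_def)
    then show ?thesis using wf_graft[OF i u] that by (auto simp: wf_subst_def intro: expr_refl)
  qed
  then have "expr_eq Q A ?es (expr_subst (graft_subst i (length ds) u) t)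
      (expr_subst (graft_subst i (length ds) ?u) t)"
    using expr_eq_subst_pointwise[OF wf_graft[OF i u] t] by blast
  moreover have "expr_eq Q A ?es (expr_subst (graft_subst i (length ds) ?u) t)
      (expr_subst (graft_subst i (length ds) ?u) ?t)"
    using expr_eq_wf[OF ds U] u i by (intro expr_eq_subst[OF wf_graft T]) auto
  ultimately have "expr_eq Q A ?es (expr_subst (graft_subst i (length ds) u) t)
      (expr_subst (graft_subst i (length ds) ?u) ?t)"
    by (rule expr_trans)
  from expr_eq_class[OF this] show ?thesis
    unfolding subst_at_def m graft_subst_def[abs_def] by (rule sym)
qed

lemma reorder_class:
  assumes cs: "set cs \<subseteq> colours Q" and \<sigma>: "\<sigma> permutes {..<length cs}" and t: "wf_expr Q A cs t"
  shows "reorder Q A (permute_list \<sigma> cs) (expr_class Q A cs t) \<sigma>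
    = expr_class Q A (permute_list \<sigma> cs) (expr_subst (\<lambda>j. Var (inv \<sigma> j)) t)"
  using expr_eq_subst[OF wf_reorder[OF \<sigma>] rep_class[OF t]]
  by (simp add: reorder_def expr_eq_class)

lemma expr_value_restrict:
  "wf_expr Q A cs t \<Longrightarrow> expr_value B (restrict g (carrier A)) bs t = expr_value B g bs t"
  by (induction t) (auto intro!: arg_cong[where f = "eval B _"])

lemma colours_col: "set as \<subseteq> carrier A \<Longrightarrow> set (map (col A) as) \<subseteq> colours Q"
  using col_closed by auto

text \<open>
  The value in \<open>A\<close> itself. The identity function is a homomorphism only after restriction to the
  carrier, whence the detour through \<open>expr_value_restrict\<close> in the next lemmas.
\<close>

abbreviation val :: "'a list \<Rightarrow> ('q, 'a) expr \<Rightarrow> 'a" where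
  "val \<equiv> expr_value A (\<lambda>a. a)"

lemma val_wf:
  assumes "set as \<subseteq> carrier A" "wf_expr Q A (map (col A) as) t"
  shows "val as t \<in> carrier A" "col A (val as t) = expr_col Q A (map (col A) as) t"
  using value_wf[OF operad_algebra_axioms id_hom assms]
  unfolding expr_value_restrict[OF assms(2)] by auto

lemma val_evaluable:
  assumes "set as \<subseteq> carrier A" "wf_expr Q A (map (col A) as) (App q ts)"
  shows "evaluable Q A q (map (val as) ts)"
proof -
  have "map (col A) (map (val as) ts) = inputs Q q"
    using val_wf(2)[OF assms(1)] assms(2) by (auto intro: map_eqI)
  then show ?thesis using assms val_wf(1)[OF assms(1)] by (auto simp: evaluable_def)
qed

lemma val_eq:
  assumes "set as \<subseteq> carrier A" "expr_eq Q A (map (col A) as) t u"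
  shows "val as t = val as u"
proof -
  have w: "wf_expr Q A (map (col A) as) t" "wf_expr Q A (map (col A) as) u"
    using expr_eq_wf_col[OF colours_col[OF assms(1)] assms(2)] by auto
  show ?thesis using value_eq[OF operad_algebra_axioms id_hom assms]
    unfolding expr_value_restrict[OF w(1)] expr_value_restrict[OF w(2)] .
qed

lemma elem_value_id_class:
  assumes "set as \<subseteq> carrier A" "wf_expr Q A (map (col A) as) t"
  shows "elem_value A (\<lambda>a. a) as (expr_class Q A (map (col A) as) t) = val as t"
  using val_eq[OF assms(1) rep_class[OF assms(2)]] by (simp add: elem_value_def)

end

section \<open>The plus construction is an operad with algebra the identity of A\<close>

lemma BD_plus_simps:
  "colours (BD_plus Q A) = carrier A"
  "ops (BD_plus Q A) = {(as, q). evaluable Q A q as}"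
  "inputs (BD_plus Q A) (as, q) = as"
  "result (BD_plus Q A) (as, q) = eval A q as"
  "unit (BD_plus Q A) a = ([a], unit Q (col A a))"
  "pcomp (BD_plus Q A) (as, q) i (bs, r) = (insert_at as i bs, pcomp Q q i r)"
  "act (BD_plus Q A) (as, q) \<sigma> = (permute_list \<sigma> as, act Q q \<sigma>)"
  by (simp_all add: BD_plus_def)

lemma id_plus_simps:
  "carrier (id_plus A) = carrier A" "col (id_plus A) = (\<lambda>a. a)" "eval (id_plus A) (as, q) = eval A q"
  by (simp_all add: over_algebra_def)

lemma evaluable_id_plus:
  "evaluable (BD_plus Q A) (id_plus A) (as, q) bs \<longleftrightarrow> bs = as \<and> evaluable Q A q as"
  by (auto simp: evaluable_def BD_plus_simps id_plus_simps)

lemma length_evaluable: "evaluable Q A q as \<Longrightarrow> length (inputs Q q) = length as"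
  by (metis evaluable_def length_map)

context operad_with_algebra
begin

lemma composable_BD_plus:
  "composable (BD_plus Q A) (as, q) i (bs, r)
    \<longleftrightarrow> evaluable Q A q as \<and> evaluable Q A r bs \<and> i < length as \<and> eval A r bs = as ! i"
  by (auto simp: composable_def BD_plus_simps)

lemma composable_if_composable_BD_plus:
  assumes "composable (BD_plus Q A) (as, q) i (bs, r)"
  shows "composable Q q i r"
proof -
  note c = assms[unfolded composable_BD_plus]
  then have "result Q r = col A (as ! i)" using col_eval by metis
  also have "\<dots> = inputs Q q ! i" using c by (auto simp: evaluable_def dest!: sym[of "map _ _"])
  finally show ?thesis using c length_evaluable[of Q A q as] by (auto simp: composable_def evaluable_def)
qed

lemma evaluable_unit: "a \<in> carrier A \<Longrightarrow> evaluable Q A (unit Q (col A a)) [a]"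
  by (simp add: evaluable_def unit_ops inputs_unit col_closed)

text \<open>
  Composites in the plus construction are composites in \<open>Q\<close> whose arguments fit; that the value
  stays the same is the compatibility of the algebra \<open>A\<close> with composition.
\<close>

lemma evaluable_pcomp:
  assumes "composable (BD_plus Q A) (as, q) i (bs, r)"
  shows "evaluable Q A (pcomp Q q i r) (insert_at as i bs)"
    and "eval A (pcomp Q q i r) (insert_at as i bs) = eval A q as"
proof -
  note c = assms[unfolded composable_BD_plus] and c' = composable_if_composable_BD_plus[OF assms]
  obtain xs zs where s: "as = xs @ as ! i # zs" "length xs = i" using split_at c by metis
  have e: "evaluable Q A q (xs @ eval A r bs # zs)" using c s by metis
  have "map (col A) (insert_at as i bs) = inputs Q (pcomp Q q i r)"
    using c inputs_pcomp[OF c'] by (simp add: map_insert_at evaluable_def)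
  moreover have "set (insert_at as i bs) \<subseteq> carrier A"
    using c set_take_subset[of i as] set_drop_subset[of "Suc i" as]
    by (auto simp: insert_at_def evaluable_def)
  ultimately show "evaluable Q A (pcomp Q q i r) (insert_at as i bs)"
    using pcomp_ops[OF c'] by (simp add: evaluable_def)
  have "insert_at as i bs = xs @ bs @ zs" using insert_at_split s by metis
  then show "eval A (pcomp Q q i r) (insert_at as i bs) = eval A q as"
    using eval_pcomp[OF _ e] c s by metis
qed

lemma evaluable_act:
  assumes "evaluable Q A q as" "\<sigma> permutes {..<length as}"
  shows "evaluable Q A (act Q q \<sigma>) (permute_list \<sigma> as)"
proof -
  have \<sigma>: "\<sigma> permutes {..<length (inputs Q q)}" using assms length_evaluable[OF assms(1)] by simp
  have "map (col A) (permute_list \<sigma> as) = inputs Q (act Q q \<sigma>)"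
    using assms inputs_act[OF _ \<sigma>] by (simp add: permute_list_map[symmetric] evaluable_def)
  then show ?thesis using assms act_ops[OF _ \<sigma>] by (simp add: evaluable_def)
qed

text \<open>
  Each axiom is a pair of equations: one of lists, and the same axiom for \<open>Q\<close>.
\<close>

lemma operad_BD_plus: "operad (BD_plus Q A)"
proof
  fix x assume "x \<in> ops (BD_plus Q A)"
  then obtain as q where x: "x = (as, q)" and e: "evaluable Q A q as" by (auto simp: BD_plus_simps)
  have len: "length (inputs Q q) = length as" using length_evaluable[OF e] .
  have q: "q \<in> ops Q" "map (col A) as = inputs Q q" using e by (auto simp: evaluable_def)
  show "set (inputs (BD_plus Q A) x) \<subseteq> colours (BD_plus Q A)"
    using e by (simp add: x BD_plus_simps evaluable_def)
  show "result (BD_plus Q A) x \<in> colours (BD_plus Q A)"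
    using eval_closed[OF e] by (simp add: x BD_plus_simps)
  show "pcomp (BD_plus Q A) (unit (BD_plus Q A) (result (BD_plus Q A) x)) 0 x = x"
    using unit_left[OF q(1)] by (simp add: x BD_plus_simps insert_at_unit(1) col_eval[OF e])
  show "pcomp (BD_plus Q A) x i (unit (BD_plus Q A) (inputs (BD_plus Q A) x ! i)) = x"
    if "i < length (inputs (BD_plus Q A) x)" for i
  proof -
    have "col A (as ! i) = inputs Q q ! i" using that by (simp add: x BD_plus_simps q(2)[symmetric])
    then show ?thesis using that len unit_right[OF q(1)]
      by (simp add: x BD_plus_simps insert_at_unit(2))
  qed
  show "act (BD_plus Q A) x id = x" using act_id[OF q(1)] by (simp add: x BD_plus_simps)
  fix \<sigma> assume s: "\<sigma> permutes {..<length (inputs (BD_plus Q A) x)}"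
  then have \<sigma>: "\<sigma> permutes {..<length as}" by (simp add: x BD_plus_simps)
  show "act (BD_plus Q A) x \<sigma> \<in> ops (BD_plus Q A)"
    using evaluable_act[OF e \<sigma>] by (simp add: x BD_plus_simps)
  show "inputs (BD_plus Q A) (act (BD_plus Q A) x \<sigma>) = permute_list \<sigma> (inputs (BD_plus Q A) x)"
    by (simp add: x BD_plus_simps)
  show "result (BD_plus Q A) (act (BD_plus Q A) x \<sigma>) = result (BD_plus Q A) x"
    using eval_act[OF e \<sigma>] by (simp add: x BD_plus_simps)
  fix \<tau> assume "\<tau> permutes {..<length (inputs (BD_plus Q A) x)}"
  then have \<tau>: "\<tau> permutes {..<length as}" by (simp add: x BD_plus_simps)
  show "act (BD_plus Q A) (act (BD_plus Q A) x \<sigma>) \<tau> = act (BD_plus Q A) x (\<sigma> \<circ> \<tau>)"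
    using act_act[OF q(1), unfolded len, OF \<sigma> \<tau>] permute_list_compose[OF \<tau>]
    by (simp add: x BD_plus_simps)
next
  fix c assume "c \<in> colours (BD_plus Q A)"
  then have c: "c \<in> carrier A" by (simp add: BD_plus_simps)
  then show "unit (BD_plus Q A) c \<in> ops (BD_plus Q A)"
    "inputs (BD_plus Q A) (unit (BD_plus Q A) c) = [c]"
    "result (BD_plus Q A) (unit (BD_plus Q A) c) = c"
    using evaluable_unit[OF c] eval_unit[OF c] by (simp_all add: BD_plus_simps)
next
  fix x i y assume c: "composable (BD_plus Q A) x i y"
  obtain as q bs r where xy: "x = (as, q)" "y = (bs, r)" by fastforce
  note c' = c[unfolded xy]
  note C = c'[unfolded composable_BD_plus] composable_if_composable_BD_plus[OF c']
  show "pcomp (BD_plus Q A) x i y \<in> ops (BD_plus Q A)"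
    "inputs (BD_plus Q A) (pcomp (BD_plus Q A) x i y)
      = insert_at (inputs (BD_plus Q A) x) i (inputs (BD_plus Q A) y)"
    "result (BD_plus Q A) (pcomp (BD_plus Q A) x i y) = result (BD_plus Q A) x"
    using evaluable_pcomp[OF c'] by (simp_all add: xy BD_plus_simps)
  fix z :: "'a list \<times> 'q"
  obtain cs s where z: "z = (cs, s)" by fastforce
  show "pcomp (BD_plus Q A) (pcomp (BD_plus Q A) x i y) (i + j) z
      = pcomp (BD_plus Q A) x i (pcomp (BD_plus Q A) y j z)"
    if d: "composable (BD_plus Q A) y j z" for j
  proof -
    note d' = d[unfolded xy z]
    show ?thesis
      using assoc_sequential[OF C(2) composable_if_composable_BD_plus[OF d']]
        insert_at_sequential[of i as j bs cs] C(1) d'[unfolded composable_BD_plus]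
      by (simp add: xy z BD_plus_simps)
  qed
  show "pcomp (BD_plus Q A) (pcomp (BD_plus Q A) x i y)
        (k + length (inputs (BD_plus Q A) y) - 1) z
      = pcomp (BD_plus Q A) (pcomp (BD_plus Q A) x k z) i y"
    if d: "composable (BD_plus Q A) x k z" and k: "i < k" for k
  proof -
    note d' = d[unfolded xy z]
    show ?thesis
      using assoc_parallel[OF C(2) composable_if_composable_BD_plus[OF d'] k]
        insert_at_parallel[OF k, of as bs cs] C(1) d'[unfolded composable_BD_plus]
        length_evaluable[of Q A r bs]
      by (simp add: xy z BD_plus_simps)
  qed
next
  fix \<sigma> x i y \<tau>
  assume s: "\<sigma> permutes {..<length (inputs (BD_plus Q A) x)}" and i: "i < length (inputs (BD_plus Q A) x)"
    and c: "composable (BD_plus Q A) x (\<sigma> i) y" and t: "\<tau> permutes {..<length (inputs (BD_plus Q A) y)}"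
  obtain as q bs r where xy: "x = (as, q)" "y = (bs, r)" by fastforce
  note c' = c[unfolded xy]
  note C = c'[unfolded composable_BD_plus] composable_if_composable_BD_plus[OF c']
  have len: "length (inputs Q q) = length as" "length (inputs Q r) = length bs"
    using C(1) length_evaluable by metis+
  have p: "\<sigma> permutes {..<length as}" "i < length as" "\<tau> permutes {..<length bs}"
    using s i t by (simp_all add: xy BD_plus_simps)
  show "pcomp (BD_plus Q A) (act (BD_plus Q A) x \<sigma>) i (act (BD_plus Q A) y \<tau>)
      = act (BD_plus Q A) (pcomp (BD_plus Q A) x (\<sigma> i) y)
          (perm_pcomp \<sigma> i (length (inputs (BD_plus Q A) y)) \<tau>)"
    using equivariance[of \<sigma> q i r \<tau>] C(2) insert_at_permute[OF p] p
    by (simp add: xy BD_plus_simps len)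
qed

lemma algebra_id_plus: "operad_algebra (BD_plus Q A) (id_plus A)"
proof
  fix a assume "a \<in> carrier (id_plus A)"
  then have a: "a \<in> carrier A" by (simp add: id_plus_simps)
  then show "col (id_plus A) a \<in> colours (BD_plus Q A)" by (simp add: id_plus_simps BD_plus_simps)
  show "eval (id_plus A) (unit (BD_plus Q A) (col (id_plus A) a)) [a] = a"
    using eval_unit[OF a] by (simp add: id_plus_simps BD_plus_simps)
next
  fix x as assume e: "evaluable (BD_plus Q A) (id_plus A) x as"
  obtain bs q where x: "x = (bs, q)" by fastforce
  have e: "bs = as" "evaluable Q A q as" using e by (auto simp: x evaluable_id_plus)
  show "eval (id_plus A) x as \<in> carrier (id_plus A)"
    "col (id_plus A) (eval (id_plus A) x as) = result (BD_plus Q A) x"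
    using eval_closed[OF e(2)] e by (simp_all add: x id_plus_simps BD_plus_simps)
  fix \<sigma> assume "\<sigma> permutes {..<length as}"
  then show "eval (id_plus A) (act (BD_plus Q A) x \<sigma>) (permute_list \<sigma> as) = eval (id_plus A) x as"
    using eval_act[OF e(2)] by (simp add: x id_plus_simps BD_plus_simps)
next
  fix x y as bs as'
  assume y: "evaluable (BD_plus Q A) (id_plus A) y bs"
    and x: "evaluable (BD_plus Q A) (id_plus A) x (as @ eval (id_plus A) y bs # as')"
  obtain ds q es r where xy: "x = (ds, q)" "y = (es, r)" by fastforce
  show "eval (id_plus A) (pcomp (BD_plus Q A) x (length as) y) (as @ bs @ as')
      = eval (id_plus A) x (as @ eval (id_plus A) y bs # as')"
    using x y eval_pcomp[of r bs q as as']
    by (simp add: xy evaluable_id_plus id_plus_simps BD_plus_simps)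
qed

lemma operad_with_algebra_plus: "operad_with_algebra (BD_plus Q A) (id_plus A)"
  by (simp add: operad_with_algebra_def operad_BD_plus algebra_id_plus)

end

section \<open>Twisted arrow operations and annotated expressions\<close>

lemma UOp_simps:
  "colours (UOp Q A) = colours Q"
  "ops (UOp Q A) = {(cs, E). set cs \<subseteq> colours Q \<and> E \<in> multilinear Q A cs}"
  "inputs (UOp Q A) (cs, E) = cs"
  "result (UOp Q A) (cs, E) = col (free_coproduct Q A cs) E"
  "unit (UOp Q A) c = ([c], expr_class Q A [c] (Var 0))"
  "pcomp (UOp Q A) (cs, E) i (ds, G)
    = (insert_at cs i ds, subst_at Q A (insert_at cs i ds) E i (length ds) G)"
  "act (UOp Q A) (cs, E) \<sigma> = (permute_list \<sigma> cs, reorder Q A (permute_list \<sigma> cs) E \<sigma>)"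
  by (simp_all add: UOp_def Let_def)

lemma TwOp_simps:
  "colours (TwOp Q A) = carrier A"
  "ops (TwOp Q A) = {(as, E). set as \<subseteq> carrier A \<and> E \<in> multilinear Q A (map (col A) as)}"
  "inputs (TwOp Q A) (as, E) = as"
  "result (TwOp Q A) (as, E) = elem_value A (\<lambda>a. a) as E"
  "unit (TwOp Q A) a = ([a], expr_class Q A [col A a] (Var 0))"
  "pcomp (TwOp Q A) (as, E) i (bs, G)
    = (insert_at as i bs,
       subst_at Q A (insert_at (map (col A) as) i (map (col A) bs)) E i (length bs) G)"
  "act (TwOp Q A) (as, E) \<sigma>
    = (permute_list \<sigma> as, reorder Q A (map (col A) (permute_list \<sigma> as)) E \<sigma>)"
  by (simp_all add: TwOp_def Let_def map_insert_at)

text \<open>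
  An expression over \<open>(Q,A)\<^sup>+\<close> is an expression over \<open>Q\<close> in which each node also lists the values
  of its arguments.
\<close>

fun erase :: "('a list \<times> 'q, 'a) expr \<Rightarrow> ('q, 'a) expr" where
  "erase (Var j) = Var j"
| "erase (Elem a) = Elem a"
| "erase (App x ts) = App (snd x) (map erase ts)"

fun annotate :: "('c, 'q, 'a) algebra \<Rightarrow> 'a list \<Rightarrow> ('q, 'a) expr \<Rightarrow> ('a list \<times> 'q, 'a) expr" where
  "annotate A as (Var j) = Var j"
| "annotate A as (Elem a) = Elem a"
| "annotate A as (App q ts) =
     App (map (expr_value A (\<lambda>a. a) as) ts, q) (map (annotate A as) ts)"

lemma erase_annotate: "erase (annotate A as t) = t"
  by (induction t) (auto intro: map_idI)

lemma var_list_erase: "var_list (erase t) = var_list t"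
  by (induction t) (auto simp: comp_def intro!: arg_cong[where f = concat])

lemma expr_vars_erase: "expr_vars (erase t) = expr_vars t"
  by (metis mset_var_list var_list_erase)

lemma expr_vars_annotate: "expr_vars (annotate A as t) = expr_vars t"
  by (metis expr_vars_erase erase_annotate)

text \<open>
  A substitution does not change the recorded values if the substituted expressions have the
  values of the variables that they replace. In an operadic composite of twisted arrow operations
  this is the condition of composability.
\<close>

lemma annotate_subst:
  assumes "\<And>j. j \<in> set (var_list t) \<Longrightarrow>
      annotate A es (s j) = s' j \<and> expr_value A (\<lambda>a. a) es (s j) = as ! j"
  shows "annotate A es (expr_subst s t) = expr_subst s' (annotate A as t)"
  using assms
proof (induction t)
  case (App q ts)
  have "expr_value A (\<lambda>a. a) es (expr_subst s t) = expr_value A (\<lambda>a. a) as t" if "t \<in> set ts" for t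
    using App(2) that by (intro expr_value_subst) auto
  moreover have "annotate A es (expr_subst s t) = expr_subst s' (annotate A as t)" if "t \<in> set ts" for t
    using App that by auto
  ultimately show ?case by auto
qed auto

lemma annotate_graft:
  assumes i: "i < length as" and t: "wf_expr Q A cs t" "length cs = length as"
    and u: "wf_expr Q A ds u" "length ds = length bs" "expr_value A (\<lambda>a. a) bs u = as ! i"
  shows "annotate A (insert_at as i bs) (expr_subst (graft_subst i (length bs) u) t)
    = expr_subst (graft_subst i (length bs) (annotate A bs u)) (annotate A as t)"
proof (rule annotate_subst)
  fix j assume "j \<in> set (var_list t)"
  then have j: "j < length as" using var_list_less[OF t(1)] t(2) by simp
  have "annotate A (insert_at as i bs) (expr_subst (\<lambda>l. Var (i + l)) u)
      = expr_subst (\<lambda>l. Var (i + l)) (annotate A bs u)"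
    using var_list_less[OF u(1)] u(2) nth_insert_at(2)[OF i, of _ bs]
    by (intro annotate_subst) auto
  then have "annotate A (insert_at as i bs) (graft_subst i (length bs) u j)
      = graft_subst i (length bs) (annotate A bs u) j"
    by (simp add: graft_subst_def)
  moreover have "as[i := as ! i] ! j = as ! j" by simp
  ultimately show "annotate A (insert_at as i bs) (graft_subst i (length bs) u j)
      = graft_subst i (length bs) (annotate A bs u) j
    \<and> expr_value A (\<lambda>a. a) (insert_at as i bs) (graft_subst i (length bs) u j) = as ! j"
    using value_graft_subst[OF i u(1,2) j] u(3) by metis
qed

lemma annotate_reorder:
  assumes \<sigma>: "\<sigma> permutes {..<length as}" and t: "wf_expr Q A cs t" "length cs = length as"
  shows "annotate A (permute_list \<sigma> as) (expr_subst (\<lambda>j. Var (inv \<sigma> j)) t)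
    = expr_subst (\<lambda>j. Var (inv \<sigma> j)) (annotate A as t)"
  using nth_permute_list_inv[OF \<sigma>] var_list_less[OF t(1)] t(2) by (intro annotate_subst) auto

context operad_with_algebra
begin

interpretation plus: operad_with_algebra "BD_plus Q A" "id_plus A"
  by (rule operad_with_algebra_plus)

lemma TwOp_opsE:
  assumes "x \<in> ops (TwOp Q A)"
  obtains as t where "x = (as, expr_class Q A (map (col A) as) t)" "set as \<subseteq> carrier A"
    "wf_expr Q A (map (col A) as) t" "\<And>i. i < length as \<Longrightarrow> count (expr_vars t) i = 1"
proof -
  obtain as E where x: "x = (as, E)" "set as \<subseteq> carrier A" "E \<in> multilinear Q A (map (col A) as)"
    using assms by (auto simp: TwOp_simps)
  show thesis using that[of as "rep E"] multilinear_rep[OF colours_col[OF x(2)] x(3)] x by simp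
qed

lemma TwOp_class_ops:
  assumes "set as \<subseteq> carrier A" "wf_expr Q A (map (col A) as) t"
    "\<And>i. i < length as \<Longrightarrow> count (expr_vars t) i = 1"
  shows "(as, expr_class Q A (map (col A) as) t) \<in> ops (TwOp Q A)"
  using assms multilinear_class[OF assms(2)] by (simp add: TwOp_simps)

lemma result_TwOp_class:
  assumes "set as \<subseteq> carrier A" "wf_expr Q A (map (col A) as) t"
  shows "result (TwOp Q A) (as, expr_class Q A (map (col A) as) t) = val as t"
  using elem_value_id_class[OF assms] by (simp add: TwOp_simps)

lemma pcomp_TwOp_class:
  assumes i: "i < length as" and as: "set as \<subseteq> carrier A" and bs: "set bs \<subseteq> carrier A"
    and t: "wf_expr Q A (map (col A) as) t" and u: "wf_expr Q A (map (col A) bs) u"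
    and r: "val bs u = as ! i"
  shows "pcomp (TwOp Q A) (as, expr_class Q A (map (col A) as) t) i
      (bs, expr_class Q A (map (col A) bs) u)
    = (insert_at as i bs, expr_class Q A (map (col A) (insert_at as i bs))
        (expr_subst (graft_subst i (length bs) u) t))"
    and "wf_expr Q A (map (col A) (insert_at as i bs)) (expr_subst (graft_subst i (length bs) u) t)"
proof -
  have c: "expr_col Q A (map (col A) bs) u = map (col A) as ! i"
    using val_wf(2)[OF bs u] i r by simp
  show "pcomp (TwOp Q A) (as, expr_class Q A (map (col A) as) t) i
      (bs, expr_class Q A (map (col A) bs) u)
    = (insert_at as i bs, expr_class Q A (map (col A) (insert_at as i bs))
        (expr_subst (graft_subst i (length bs) u) t))"
    using subst_at_class[OF colours_col[OF as] colours_col[OF bs] _ t u c, of "length bs"] i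
    by (simp add: TwOp_simps map_insert_at)
  show "wf_expr Q A (map (col A) (insert_at as i bs)) (expr_subst (graft_subst i (length bs) u) t)"
    using wf_substD[OF wf_graft[OF _ u c] t] i by (simp add: map_insert_at)
qed

lemma act_TwOp_class:
  assumes \<sigma>: "\<sigma> permutes {..<length as}" and as: "set as \<subseteq> carrier A"
    and t: "wf_expr Q A (map (col A) as) t"
  shows "act (TwOp Q A) (as, expr_class Q A (map (col A) as) t) \<sigma>
    = (permute_list \<sigma> as, expr_class Q A (map (col A) (permute_list \<sigma> as))
        (expr_subst (\<lambda>j. Var (inv \<sigma> j)) t))"
    and "wf_expr Q A (map (col A) (permute_list \<sigma> as)) (expr_subst (\<lambda>j. Var (inv \<sigma> j)) t)"
  using reorder_class[OF colours_col[OF as] _ t] wf_substD[OF wf_reorder t] \<sigma>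
  by (simp_all add: TwOp_simps permute_list_map)

lemma wf_annotate:
  assumes "set as \<subseteq> carrier A" "wf_expr Q A (map (col A) as) t"
  shows "wf_expr (BD_plus Q A) (id_plus A) as (annotate A as t)
    \<and> expr_col (BD_plus Q A) (id_plus A) as (annotate A as t) = val as t"
  using assms(2)
proof (induction t)
  case (App q ts)
  then have IH: "\<forall>t\<in>set ts. wf_expr (BD_plus Q A) (id_plus A) as (annotate A as t)
    \<and> expr_col (BD_plus Q A) (id_plus A) as (annotate A as t) = val as t" by simp
  show ?case using IH val_evaluable[OF assms(1) App(2)] by (simp add: BD_plus_simps)
qed (auto simp: id_plus_simps)

text \<open>
  In a well-formed expression over \<open>(Q,A)\<^sup>+\<close> the recorded lists are forced to be the values of the
  arguments, since the colour of a subexpression is its value. So nothing is lost by forgetting them.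
\<close>

lemma wf_erase:
  assumes as: "set as \<subseteq> carrier A" and "wf_expr (BD_plus Q A) (id_plus A) as t"
  shows "wf_expr Q A (map (col A) as) (erase t)
    \<and> val as (erase t) = expr_col (BD_plus Q A) (id_plus A) as t \<and> annotate A as (erase t) = t"
  using assms(2)
proof (induction t)
  case (App x ts)
  obtain bs q where x: "x = (bs, q)" by fastforce
  have e: "evaluable Q A q bs" and bs: "map (expr_col (BD_plus Q A) (id_plus A) as) ts = bs"
    using App(2) by (auto simp: x BD_plus_simps)
  have IH: "wf_expr Q A (map (col A) as) (erase t)"
    "val as (erase t) = expr_col (BD_plus Q A) (id_plus A) as t" "annotate A as (erase t) = t"
    if "t \<in> set ts" for t using App that by auto
  have v: "map (val as) (map erase ts) = bs" using IH(2) by (simp add: bs[symmetric])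
  have a: "map (annotate A as) (map erase ts) = ts" using IH(3) by (auto intro: map_idI)
  have "map (expr_col Q A (map (col A) as)) (map erase ts) = map (col A) (map (val as) (map erase ts))"
    using val_wf(2)[OF as IH(1)] by simp
  then have "map (expr_col Q A (map (col A) as)) (map erase ts) = inputs Q q"
    using e unfolding v by (simp add: evaluable_def)
  then show ?case using IH e a v by (simp add: x evaluable_def BD_plus_simps)
qed (auto simp: id_plus_simps)

text \<open>
  Annotation sends each generating relation for \<open>Q\<close> to the corresponding one for \<open>(Q,A)\<^sup>+\<close>: related
  arguments have equal values, so related nodes are given the same operation.
\<close>

lemma expr_eq_annotate:
  assumes as: "set as \<subseteq> carrier A" and "expr_eq Q A (map (col A) as) t u"
  shows "expr_eq (BD_plus Q A) (id_plus A) as (annotate A as t) (annotate A as u)"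
  using assms(2)
proof (induction)
  case (expr_refl t)
  then show ?case using wf_annotate[OF as] by (blast intro: expr_eq.expr_refl)
next
  case (expr_cong q ts us)
  then have "map (val as) ts = map (val as) us"
    by (auto simp: list_all2_conv_all_nth val_eq[OF as] intro!: nth_equalityI)
  then show ?case using expr_cong(2) wf_annotate[OF as expr_cong(1)]
    by (auto simp: list_all2_conv_all_nth intro!: expr_eq.expr_cong)
next
  case (expr_unit t)
  then show ?case
    using wf_annotate[OF as expr_unit] expr_eq.expr_unit[of "BD_plus Q A" "id_plus A" as "annotate A as t"]
    by (simp add: BD_plus_simps val_wf[OF as])
next
  case (expr_pcomp q ts r us ts')
  have "expr_eq (BD_plus Q A) (id_plus A) as
    (App (pcomp (BD_plus Q A) (map (val as) ts @ eval A r (map (val as) us) # map (val as) ts', q)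
        (length (map (annotate A as) ts)) (map (val as) us, r))
      (map (annotate A as) ts @ map (annotate A as) us @ map (annotate A as) ts'))
    (App (map (val as) ts @ eval A r (map (val as) us) # map (val as) ts', q)
      (map (annotate A as) ts @ App (map (val as) us, r) (map (annotate A as) us) # map (annotate A as) ts'))"
    using wf_annotate[OF as expr_pcomp] by (intro expr_eq.expr_pcomp) simp
  then show ?case
    using insert_at_split[of "map (val as) ts"] by (simp add: BD_plus_simps)
next
  case (expr_act q ts \<sigma>)
  then show ?case using wf_annotate[OF as expr_act(1)]
      expr_eq.expr_act[of "BD_plus Q A" "id_plus A" as "(map (val as) ts, q)" "map (annotate A as) ts" \<sigma>]
    by (simp add: BD_plus_simps permute_list_map)
next
  case (expr_eval q bs)
  then show ?case
    using expr_eq.expr_eval[of "BD_plus Q A" "id_plus A" "(bs, q)" bs as]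
    by (simp add: evaluable_id_plus id_plus_simps comp_def)
qed (auto intro: expr_eq.expr_sym expr_eq.expr_trans)

lemma expr_eq_erase:
  assumes as: "set as \<subseteq> carrier A" and "expr_eq (BD_plus Q A) (id_plus A) as t u"
  shows "expr_eq Q A (map (col A) as) (erase t) (erase u)"
  using assms(2)
proof (induction)
  case (expr_refl t)
  then show ?case using wf_erase[OF as] by (blast intro: expr_eq.expr_refl)
next
  case (expr_cong q ts us)
  then show ?case using wf_erase[OF as expr_cong(1)]
    by (auto simp: list_all2_conv_all_nth intro!: expr_eq.expr_cong)
next
  case (expr_unit t)
  then show ?case
    using wf_erase[OF as expr_unit] expr_eq.expr_unit[of Q A "map (col A) as" "erase t"]
      val_wf(2)[OF as, of "erase t"]
    by (simp add: BD_plus_simps)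
next
  case (expr_pcomp x ts y us ts')
  obtain bs q ds r where xy: "x = (bs, q)" "y = (ds, r)" by fastforce
  show ?case using wf_erase[OF as expr_pcomp]
      expr_eq.expr_pcomp[of Q A "map (col A) as" q "map erase ts" r "map erase us" "map erase ts'"]
    by (simp add: xy BD_plus_simps)
next
  case (expr_act x ts \<sigma>)
  obtain bs q where x: "x = (bs, q)" by fastforce
  show ?case using expr_act(2) wf_erase[OF as expr_act(1)]
      expr_eq.expr_act[of Q A "map (col A) as" q "map erase ts" \<sigma>]
    by (simp add: x BD_plus_simps permute_list_map)
next
  case (expr_eval x bs)
  obtain ds q where x: "x = (ds, q)" by fastforce
  show ?case using expr_eval expr_eq.expr_eval[of Q A q ds "map (col A) as"]
    by (simp add: x evaluable_id_plus id_plus_simps comp_def)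
qed (auto intro: expr_eq.expr_sym expr_eq.expr_trans)

section \<open>The twisted arrow operad as an enveloping operad\<close>

definition annotate_op :: "'a list \<times> ('q, 'a) expr set \<Rightarrow> 'a list \<times> ('a list \<times> 'q, 'a) expr set" where
  "annotate_op = (\<lambda>(as, E). (as, expr_class (BD_plus Q A) (id_plus A) as (annotate A as (rep E))))"

definition erase_op :: "'a list \<times> ('a list \<times> 'q, 'a) expr set \<Rightarrow> 'a list \<times> ('q, 'a) expr set" where
  "erase_op = (\<lambda>(as, E). (as, expr_class Q A (map (col A) as) (erase (rep E))))"

lemma annotate_op_class:
  assumes "set as \<subseteq> carrier A" "wf_expr Q A (map (col A) as) t"
  shows "annotate_op (as, expr_class Q A (map (col A) as) t)
    = (as, expr_class (BD_plus Q A) (id_plus A) as (annotate A as t))"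
  using plus.expr_eq_class[OF expr_eq_annotate[OF assms(1) rep_class[OF assms(2)]]]
  by (simp add: annotate_op_def)

lemma erase_op_class:
  assumes "set as \<subseteq> carrier A" "wf_expr (BD_plus Q A) (id_plus A) as t"
  shows "erase_op (as, expr_class (BD_plus Q A) (id_plus A) as t)
    = (as, expr_class Q A (map (col A) as) (erase t))"
  using expr_eq_class[OF expr_eq_erase[OF assms(1) plus.rep_class[OF assms(2)]]]
  by (simp add: erase_op_def)

lemma bij_annotate_op:
  "bij_betw annotate_op (ops (TwOp Q A)) (ops (UOp (BD_plus Q A) (id_plus A)))"
proof (rule bij_betw_byWitness[where f' = erase_op])
  show "\<forall>x\<in>ops (TwOp Q A). erase_op (annotate_op x) = x"
  proof
    fix x assume "x \<in> ops (TwOp Q A)"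
    then show "erase_op (annotate_op x) = x"
      by (rule TwOp_opsE)
        (use annotate_op_class erase_op_class wf_annotate in \<open>simp add: erase_annotate\<close>)
  qed
  show "annotate_op ` ops (TwOp Q A) \<subseteq> ops (UOp (BD_plus Q A) (id_plus A))"
  proof (rule image_subsetI)
    fix x assume "x \<in> ops (TwOp Q A)"
    then show "annotate_op x \<in> ops (UOp (BD_plus Q A) (id_plus A))"
      by (rule TwOp_opsE)
        (use annotate_op_class wf_annotate plus.multilinear_class in
          \<open>simp add: UOp_simps BD_plus_simps expr_vars_annotate\<close>)
  qed
  have *: "\<exists>as t. x = (as, expr_class (BD_plus Q A) (id_plus A) as t) \<and> set as \<subseteq> carrier A
      \<and> wf_expr (BD_plus Q A) (id_plus A) as t \<and> (\<forall>i<length as. count (expr_vars t) i = 1)"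
    if x: "x \<in> ops (UOp (BD_plus Q A) (id_plus A))" for x
  proof -
    obtain as E where x: "x = (as, E)" "set as \<subseteq> carrier A" "E \<in> multilinear (BD_plus Q A) (id_plus A) as"
      using x by (auto simp: UOp_simps BD_plus_simps)
    then have "set as \<subseteq> colours (BD_plus Q A)" by (simp add: BD_plus_simps)
    from plus.multilinear_rep[OF this x(3)] show ?thesis using x by metis
  qed
  show "\<forall>x\<in>ops (UOp (BD_plus Q A) (id_plus A)). annotate_op (erase_op x) = x"
    using * annotate_op_class erase_op_class wf_erase by fastforce
  show "erase_op ` ops (UOp (BD_plus Q A) (id_plus A)) \<subseteq> ops (TwOp Q A)"
  proof (rule image_subsetI)
    fix x assume "x \<in> ops (UOp (BD_plus Q A) (id_plus A))"
    from *[OF this] show "erase_op x \<in> ops (TwOp Q A)"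
      using erase_op_class wf_erase TwOp_class_ops by (auto simp: expr_vars_erase)
  qed
qed

lemma TwOp_iso_UOp_plus: "isomorphic_operads (TwOp Q A) (UOp (BD_plus Q A) (id_plus A))"
proof -
  let ?T = "TwOp Q A" and ?U = "UOp (BD_plus Q A) (id_plus A)"
  have "operad_iso ?T ?U (\<lambda>c. c) annotate_op"
    unfolding operad_iso_def
  proof (intro conjI allI ballI impI)
    show "bij_betw (\<lambda>c. c) (colours ?T) (colours ?U)"
      by (simp add: TwOp_simps UOp_simps BD_plus_simps bij_betw_def)
    show "bij_betw annotate_op (ops ?T) (ops ?U)" by (rule bij_annotate_op)
    show "inputs ?U (annotate_op x) = map (\<lambda>c. c) (inputs ?T x)" for x
      by (cases x) (simp add: annotate_op_def TwOp_simps UOp_simps)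
    show "result ?U (annotate_op x) = result ?T x" if "x \<in> ops ?T" for x
      using that
    proof (rule TwOp_opsE)
      fix as t assume *: "x = (as, expr_class Q A (map (col A) as) t)" "set as \<subseteq> carrier A"
        "wf_expr Q A (map (col A) as) t"
      then show ?thesis
        using plus.free_coproduct_col[of as "annotate A as t"] wf_annotate[of as t]
        by (simp add: annotate_op_class result_TwOp_class UOp_simps BD_plus_simps)
    qed
    show "annotate_op (unit ?T c) = unit ?U c" if "c \<in> colours ?T" for c
      using that annotate_op_class[of "[c]" "Var 0"] by (simp add: TwOp_simps UOp_simps)
    show "annotate_op (act ?T x \<sigma>) = act ?U (annotate_op x) \<sigma>"
      if "x \<in> ops ?T" "\<sigma> permutes {..<length (inputs ?T x)}" for x \<sigma>
      using that(1)
    proof (rule TwOp_opsE)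
      fix as t assume x: "x = (as, expr_class Q A (map (col A) as) t)" and as: "set as \<subseteq> carrier A"
        and t: "wf_expr Q A (map (col A) as) t"
      have \<sigma>: "\<sigma> permutes {..<length as}" using that by (simp add: x TwOp_simps)
      show ?thesis
        using plus.reorder_class[OF _ \<sigma>, of "annotate A as t"] wf_annotate[OF as t] as \<sigma>
          annotate_reorder[OF \<sigma> t]
        by (simp add: x act_TwOp_class[OF \<sigma> as t] annotate_op_class[OF as t]
            annotate_op_class[OF _ act_TwOp_class(2)[OF \<sigma> as t]] UOp_simps BD_plus_simps)
    qed
    show "annotate_op (pcomp ?T x i y) = pcomp ?U (annotate_op x) i (annotate_op y)"
      if c: "composable ?T x i y" for x i y
    proof -
      have "x \<in> ops ?T" using c by (simp add: composable_def)
      then obtain as t where x: "x = (as, expr_class Q A (map (col A) as) t)"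
        and as: "set as \<subseteq> carrier A" and t: "wf_expr Q A (map (col A) as) t" by (rule TwOp_opsE)
      have "y \<in> ops ?T" using c by (simp add: composable_def)
      then obtain bs u where y: "y = (bs, expr_class Q A (map (col A) bs) u)"
        and bs: "set bs \<subseteq> carrier A" and u: "wf_expr Q A (map (col A) bs) u" by (rule TwOp_opsE)
      have i: "i < length as" and r: "val bs u = as ! i"
        using c result_TwOp_class[OF bs u] by (auto simp: composable_def x y TwOp_simps)
      note P = pcomp_TwOp_class[OF i as bs t u r]
      have es: "set (insert_at as i bs) \<subseteq> carrier A"
        using as bs set_take_subset[of i as] set_drop_subset[of "Suc i" as]
        by (auto simp: insert_at_def)
      show ?thesis
        using plus.subst_at_class[of as bs i "annotate A as t" "annotate A bs u" "length bs"]
          as bs i r wf_annotate[OF as t] wf_annotate[OF bs u] annotate_graft[OF i t _ u _ r]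
        by (simp add: x y P(1) annotate_op_class[OF as t] annotate_op_class[OF bs u]
            annotate_op_class[OF es P(2)] UOp_simps BD_plus_simps)
    qed
  qed
  then show ?thesis unfolding isomorphic_operads_def by blast
qed

section \<open>The twisted arrow operad as a plus construction\<close>

lemma evaluable_id_UOp:
  "evaluable (UOp Q A) (id_UOp A) (cs, E) as
    \<longleftrightarrow> set as \<subseteq> carrier A \<and> cs = map (col A) as \<and> E \<in> multilinear Q A cs"
  by (auto simp: evaluable_def UOp_simps under_algebra_def intro!: col_closed)

text \<open>
  Both sides consist of the same pairs of a list of arguments and an element; the right-hand side
  stores the colours of the arguments as well.
\<close>

lemma TwOp_iso_plus_UOp: "isomorphic_operads (TwOp Q A) (BD_plus (UOp Q A) (id_UOp A))"
proof -
  let ?T = "TwOp Q A" and ?U = "BD_plus (UOp Q A) (id_UOp A)"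
  define \<Phi> where "\<Phi> = (\<lambda>(as, E). (as, (map (col A) as, E :: ('q, 'a) expr set)))"
  have ops: "ops ?U = \<Phi> ` ops ?T"
    by (auto simp: BD_plus_simps evaluable_id_UOp \<Phi>_def TwOp_simps image_iff)
  have inj: "inj_on \<Phi> (ops ?T)" by (auto simp: inj_on_def \<Phi>_def)
  have "operad_iso ?T ?U (\<lambda>c. c) \<Phi>"
    unfolding operad_iso_def
  proof (intro conjI allI ballI impI)
    show "bij_betw (\<lambda>c. c) (colours ?T) (colours ?U)"
      by (simp add: TwOp_simps BD_plus_simps under_algebra_def bij_betw_def)
    show "bij_betw \<Phi> (ops ?T) (ops ?U)" using inj by (simp add: bij_betw_def ops)
    show "inputs ?U (\<Phi> x) = map (\<lambda>c. c) (inputs ?T x)" for x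
      by (cases x) (simp add: \<Phi>_def TwOp_simps BD_plus_simps)
    show "result ?U (\<Phi> x) = result ?T x" for x
      by (cases x) (simp add: \<Phi>_def TwOp_simps BD_plus_simps under_algebra_def)
    show "\<Phi> (unit ?T c) = unit ?U c" for c
      by (simp add: \<Phi>_def TwOp_simps BD_plus_simps UOp_simps under_algebra_def)
    show "\<Phi> (pcomp ?T x i y) = pcomp ?U (\<Phi> x) i (\<Phi> y)" for x i y
      by (cases x, cases y) (simp add: \<Phi>_def TwOp_simps BD_plus_simps UOp_simps map_insert_at)
    show "\<Phi> (act ?T x \<sigma>) = act ?U (\<Phi> x) \<sigma>"
      if "x \<in> ops ?T" "\<sigma> permutes {..<length (inputs ?T x)}" for x \<sigma>
      using that
      by (cases x) (simp add: \<Phi>_def TwOp_simps BD_plus_simps UOp_simps permute_list_map)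
  qed
  then show ?thesis unfolding isomorphic_operads_def by blast
qed

end

section \<open>From retracts to algebras of the twisted arrow operad\<close>

definition corolla :: "'q \<Rightarrow> nat \<Rightarrow> ('q, 'a) expr" where
  "corolla q n = App q (map Var [0..<n])"

lemma var_list_corolla: "var_list (corolla q n) = [0..<n]"
proof -
  have "concat (map (\<lambda>j. [j]) xs) = xs" for xs :: "nat list" by (induction xs) auto
  then show ?thesis by (simp add: corolla_def comp_def)
qed

lemma expr_value_corolla: "expr_value B g bs (corolla q (length bs)) = eval B q bs"
  by (simp add: corolla_def comp_def map_nth)

lemma wf_corolla:
  "wf_expr Q A cs (corolla q (length cs)) \<longleftrightarrow> q \<in> ops Q \<and> inputs Q q = cs"
  by (auto simp: corolla_def comp_def map_nth)

lemma map_graft_subst: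
  "map (graft_subst k m u) [0..<k + Suc l]
    = map Var [0..<k] @ expr_subst (\<lambda>j. Var (k + j)) u # map Var [k + m..<k + m + l]"
  by (rule nth_equalityI) (auto simp: graft_subst_def nth_append nth_Cons' simp del: upt_Suc)

lemma graft_corolla:
  "expr_subst (graft_subst k m u) (corolla q (k + Suc l))
    = App q (map Var [0..<k] @ expr_subst (\<lambda>j. Var (k + j)) u # map Var [k + m..<k + m + l])"
  using map_graft_subst[of k m u l] by (simp add: corolla_def comp_def del: upt_Suc)

lemma count_expr_vars_upt:
  assumes "var_list t = [0..<n]" "i < n"
  shows "count (expr_vars t) i = 1"
proof -
  have "count (mset (var_list t)) i = 1" using assms distinct_upt[of 0 n] unfolding distinct_count_atmost_1 by simp
  then show ?thesis by (simp add: mset_var_list)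
qed

lemma evaluable_hom:
  assumes "h \<in> algebra_hom Q A B" "evaluable Q A q as"
  shows "evaluable Q B q (map h as)"
proof -
  have "col B (h a) = col A a" "h a \<in> carrier B" if "a \<in> set as" for a
    using assms that by (auto simp: algebra_hom_def evaluable_def)
  then show ?thesis using assms(2) by (auto simp: evaluable_def intro: map_eqI)
qed

text \<open>
  The records are equal up to their values outside of the carrier and on arguments that do not fit.
  This is what remains of an equality of algebras after passing to the other category and back.
\<close>

definition same_algebra :: "('c, 'q) operad \<Rightarrow> ('c, 'q, 'b) algebra \<Rightarrow> ('c, 'q, 'b) algebra \<Rightarrow> bool" where
  "same_algebra Q X Y \<longleftrightarrow> carrier X = carrier Y \<and> (\<forall>b\<in>carrier X. col X b = col Y b)
     \<and> (\<forall>q bs. evaluable Q X q bs \<longrightarrow> eval X q bs = eval Y q bs)"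

lemma same_algebra_hom:
  assumes "same_algebra Q X Y" "operad_algebra Q X"
  shows "restrict (\<lambda>b. b) (carrier X) \<in> algebra_hom Q X Y"
    and "restrict (\<lambda>b. b) (carrier X) \<in> algebra_hom Q Y X"
proof -
  have ev: "evaluable Q Y q bs \<longleftrightarrow> evaluable Q X q bs" for q bs
  proof -
    have "map (col Y) bs = map (col X) bs" if "set bs \<subseteq> carrier X"
      using assms(1) that by (auto simp: same_algebra_def)
    then show ?thesis using assms(1) unfolding same_algebra_def evaluable_def by metis
  qed
  have r: "map (restrict (\<lambda>b. b) (carrier X)) bs = bs" if "evaluable Q X q bs" for q bs
    using that by (intro map_idI) (auto simp: evaluable_def)
  show "restrict (\<lambda>b. b) (carrier X) \<in> algebra_hom Q X Y"
    "restrict (\<lambda>b. b) (carrier X) \<in> algebra_hom Q Y X"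
    using assms(1) r operad_algebra.eval_closed[OF assms(2)]
    by (auto simp: same_algebra_def algebra_hom_def ev)
qed

text \<open>
  \<open>B\<close> with the map \<open>f\<close> to \<open>A\<close> as the colouring; the map \<open>g\<close> from \<open>A\<close> gives the elements of \<open>A\<close>
  in an expression their values.
\<close>

definition twisted_of_retract :: "('c, 'q, 'b) algebra \<times> ('b \<Rightarrow> 'a) \<times> ('a \<Rightarrow> 'b)
    \<Rightarrow> ('a, 'a list \<times> ('q, 'a) expr set, 'b) algebra" where
  "twisted_of_retract = (\<lambda>(B, f, g).
     \<lparr> carrier = carrier B, col = f, eval = (\<lambda>(as, E) bs. elem_value B g bs E) \<rparr>)"

lemma twisted_of_retract_simps:
  "carrier (twisted_of_retract (B, f, g)) = carrier B"
  "col (twisted_of_retract (B, f, g)) = f"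
  "eval (twisted_of_retract (B, f, g)) (as, E) bs = elem_value B g bs E"
  by (simp_all add: twisted_of_retract_def)

context operad_with_algebra
begin

text \<open>
  Used in two ways: for maps of retracts, and with \<open>B' = A\<close> and \<open>g'\<close> the identity for the projection
  of a retract, where it says that \<open>(as, [t])\<close> acts with the colour of its result.
\<close>

lemma hom_expr_value:
  assumes B: "operad_algebra Q B" and g: "g \<in> algebra_hom Q A B" and bs: "set bs \<subseteq> carrier B"
    and h: "h \<in> algebra_hom Q B B'" "\<And>a. a \<in> carrier A \<Longrightarrow> h (g a) = g' a"
    and t: "wf_expr Q A (map (col B) bs) t"
  shows "h (expr_value B g bs t) = expr_value B' g' (map h bs) t"
  using t
proof (induction t)
  case (App q ts)
  have "h (expr_value B g bs (App q ts)) = eval B' q (map h (map (expr_value B g bs) ts))"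
    using h(1) value_evaluable[OF B g bs App(2)] by (auto simp: algebra_hom_def simp del: map_map)
  also have "map h (map (expr_value B g bs) ts) = map (expr_value B' g' (map h bs)) ts"
    using App by simp
  finally show ?case by simp
qed (use h in auto)

lemma elem_value_class:
  assumes B: "operad_algebra Q B" and g: "g \<in> algebra_hom Q A B" and bs: "set bs \<subseteq> carrier B"
    and t: "wf_expr Q A (map (col B) bs) t"
  shows "elem_value B g bs (expr_class Q A (map (col B) bs) t) = expr_value B g bs t"
  using value_eq[OF B g bs rep_class[OF t]] by (simp add: elem_value_def)

lemma evaluable_TwOpE:
  assumes "evaluable (TwOp Q A) X x bs"
  obtains t where "x = (map (col X) bs, expr_class Q A (map (col A) (map (col X) bs)) t)"
    "set bs \<subseteq> carrier X" "set (map (col X) bs) \<subseteq> carrier A"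
    "wf_expr Q A (map (col A) (map (col X) bs)) t"
    "\<And>i. i < length bs \<Longrightarrow> count (expr_vars t) i = 1"
proof -
  have x: "x \<in> ops (TwOp Q A)" "set bs \<subseteq> carrier X" "map (col X) bs = inputs (TwOp Q A) x"
    using assms by (auto simp: evaluable_def)
  from x(1) obtain as t where t: "x = (as, expr_class Q A (map (col A) as) t)" "set as \<subseteq> carrier A"
    "wf_expr Q A (map (col A) as) t" "\<And>i. i < length as \<Longrightarrow> count (expr_vars t) i = 1"
    by (rule TwOp_opsE) blast
  have "as = map (col X) bs" using x(3) by (simp add: t(1) TwOp_simps)
  then show thesis using that[of t] t x(2) by simp
qed

lemma operad_algebra_twisted_of_retract:
  assumes B: "operad_algebra Q B" and f: "f \<in> algebra_hom Q B A" and g: "g \<in> algebra_hom Q A B"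
    and fg: "\<And>a. a \<in> carrier A \<Longrightarrow> f (g a) = a"
  shows "operad_algebra (TwOp Q A) (twisted_of_retract (B, f, g))" (is "operad_algebra ?T ?X")
proof -
  note S = twisted_of_retract_simps
  have fc: "f b \<in> carrier A" "col A (f b) = col B b" if "b \<in> carrier B" for b
    using f that by (auto simp: algebra_hom_def)
  have cc: "map (col A) (map f bs) = map (col B) bs" if "set bs \<subseteq> carrier B" for bs
    using fc that by auto
  have E: "\<exists>t. x = (map f bs, expr_class Q A (map (col B) bs) t) \<and> set bs \<subseteq> carrier B
      \<and> set (map f bs) \<subseteq> carrier A \<and> wf_expr Q A (map (col B) bs) t
      \<and> map (col A) (map f bs) = map (col B) bs \<and> eval ?X x bs = expr_value B g bs t
      \<and> val (map f bs) t = f (expr_value B g bs t)"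
    if e: "evaluable ?T ?X x bs" for x bs
    using e
  proof (rule evaluable_TwOpE)
    fix t assume *: "x = (map (col ?X) bs, expr_class Q A (map (col A) (map (col ?X) bs)) t)"
      "set bs \<subseteq> carrier ?X" "set (map (col ?X) bs) \<subseteq> carrier A"
      "wf_expr Q A (map (col A) (map (col ?X) bs)) t"
    note c = cc[OF *(2)[unfolded S]]
    note U = *[unfolded S c]
    show ?thesis
      using U c elem_value_class[OF B g U(2,4)] hom_expr_value[OF B g U(2) f fg U(4)]
      by (intro exI[of _ t]) (auto simp: S)
  qed
  show ?thesis
  proof
    fix b assume "b \<in> carrier ?X"
    then have b: "b \<in> carrier B" by (simp add: S)
    then show "col ?X b \<in> colours ?T" using fc by (simp add: S TwOp_simps)
    show "eval ?X (unit ?T (col ?X b)) [b] = b"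
      using elem_value_class[OF B g, of "[b]" "Var 0"] b fc by (simp add: S TwOp_simps)
  next
    fix x bs assume e: "evaluable ?T ?X x bs"
    from E[OF e] obtain t where t: "x = (map f bs, expr_class Q A (map (col B) bs) t)"
      "set bs \<subseteq> carrier B" "set (map f bs) \<subseteq> carrier A" "wf_expr Q A (map (col B) bs) t"
      "map (col A) (map f bs) = map (col B) bs" "eval ?X x bs = expr_value B g bs t"
      "val (map f bs) t = f (expr_value B g bs t)" by blast
    show "eval ?X x bs \<in> carrier ?X"
      unfolding t(6) using value_wf[OF B g t(2,4)] by (simp add: S)
    show "col ?X (eval ?X x bs) = result ?T x"
      unfolding t(6) using result_TwOp_class[OF t(3)] t(4,5,7) by (simp only: t(1) S)
    fix \<sigma> assume \<sigma>: "\<sigma> permutes {..<length bs}"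
    then have \<sigma>': "\<sigma> permutes {..<length (map f bs)}" by simp
    note P = act_TwOp_class[OF \<sigma>' t(3), unfolded t(5), OF t(4)]
    have p: "permute_list \<sigma> (map f bs) = map f (permute_list \<sigma> bs)"
      using \<sigma> by (simp add: permute_list_map)
    have ps: "set (permute_list \<sigma> bs) \<subseteq> carrier B" using t(2) \<sigma> by simp
    have "eval ?X (act ?T x \<sigma>) (permute_list \<sigma> bs)
        = expr_value B g (permute_list \<sigma> bs) (expr_subst (\<lambda>j. Var (inv \<sigma> j)) t)"
      unfolding t(1) P(1) S p cc[OF ps]
      by (rule elem_value_class[OF B g ps P(2)[unfolded p cc[OF ps]]])
    then show "eval ?X (act ?T x \<sigma>) (permute_list \<sigma> bs) = eval ?X x bs"
      unfolding t(6) using value_reorder[OF \<sigma> t(4)] by simp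
  next
    fix y cs x as as'
    assume "evaluable ?T ?X y cs"
    from E[OF this] obtain u where u: "y = (map f cs, expr_class Q A (map (col B) cs) u)"
      "set cs \<subseteq> carrier B" "set (map f cs) \<subseteq> carrier A" "wf_expr Q A (map (col B) cs) u"
      "map (col A) (map f cs) = map (col B) cs" "eval ?X y cs = expr_value B g cs u"
      "val (map f cs) u = f (expr_value B g cs u)" by blast
    define b where "b = expr_value B g cs u"
    define bs where "bs = as @ b # as'"
    assume "evaluable ?T ?X x (as @ eval ?X y cs # as')"
    then have "evaluable ?T ?X x bs" by (simp add: bs_def b_def u(6))
    from E[OF this] obtain t where t: "x = (map f bs, expr_class Q A (map (col B) bs) t)"
      "set bs \<subseteq> carrier B" "set (map f bs) \<subseteq> carrier A" "wf_expr Q A (map (col B) bs) t"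
      "map (col A) (map f bs) = map (col B) bs" "eval ?X x bs = expr_value B g bs t" by blast
    have i: "length as < length bs" "bs ! length as = b" by (simp_all add: bs_def)
    have i': "length as < length (map f bs)" "val (map f cs) u = map f bs ! length as"
      using i u(7) by (simp_all add: b_def)
    note P = pcomp_TwOp_class[OF i'(1) t(3) u(3), unfolded t(5) u(5), OF t(4) u(4) i'(2)]
    have ins: "insert_at bs (length as) cs = as @ cs @ as'" by (simp add: bs_def insert_at_split)
    have p: "insert_at (map f bs) (length as) (map f cs) = map f (as @ cs @ as')"
      by (simp only: map_insert_at[symmetric] ins)
    have ps: "set (as @ cs @ as') \<subseteq> carrier B" using t(2) u(2) by (auto simp: bs_def)
    have "eval ?X (pcomp ?T x (length as) y) (as @ cs @ as')
        = expr_value B g (as @ cs @ as') (expr_subst (graft_subst (length as) (length cs) u) t)"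
      using elem_value_class[OF B g ps P(2)[unfolded p cc[OF ps]]]
      unfolding t(1) u(1) P(1) S p cc[OF ps] by simp
    also have "\<dots> = expr_value B g (bs[length as := b]) t"
      using value_graft[OF i(1) t(4) _ u(4), of cs B g] by (simp add: ins b_def)
    also have "\<dots> = eval ?X x bs" unfolding t(6) i(2)[symmetric] by simp
    finally show "eval ?X (pcomp ?T x (length as) y) (as @ cs @ as')
        = eval ?X x (as @ eval ?X y cs # as')" by (simp add: bs_def b_def u(6))
  qed
qed

end

section \<open>From algebras of the twisted arrow operad to retracts\<close>

locale twisted_algebra = operad_with_algebra Q A + tw: operad_algebra "TwOp Q A" X
  for Q :: "('c, 'q) operad" and A :: "('c, 'q, 'a) algebra"
    and X :: "('a, 'a list \<times> ('q, 'a) expr set, 'b) algebra"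
begin

definition over :: "'b list \<Rightarrow> 'a list" where
  "over bs = map (col X) bs"

definition apply_expr :: "('q, 'a) expr \<Rightarrow> 'b list \<Rightarrow> 'b" where
  "apply_expr t bs = eval X (over bs, expr_class Q A (map (col A) (over bs)) t) bs"

text \<open>
  The retract of \<open>X\<close> consists of \<open>base\<close>, \<open>proj\<close> and \<open>incl\<close>. The two maps are restricted to the carriers
  because elements of \<open>algebra_hom\<close> are extensional.
\<close>

definition base :: "('c, 'q, 'b) algebra" where
  "base = \<lparr> carrier = carrier X, col = (\<lambda>b. col A (col X b)),
            eval = (\<lambda>q bs. apply_expr (corolla q (length bs)) bs) \<rparr>"

definition incl :: "'a \<Rightarrow> 'b" where
  "incl = (\<lambda>a\<in>carrier A. apply_expr (Elem a) [])"

definition proj :: "'b \<Rightarrow> 'a" where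
  "proj = restrict (col X) (carrier X)"

lemma over_simps [simp]: "over [] = []" "over (b # bs) = col X b # over bs"
  "over (bs @ cs) = over bs @ over cs" "length (over bs) = length bs"
  by (simp_all add: over_def)

lemma over_permute: "\<sigma> permutes {..<length bs} \<Longrightarrow> over (permute_list \<sigma> bs) = permute_list \<sigma> (over bs)"
  by (simp add: over_def permute_list_map)

lemma col_base: "map (col base) bs = map (col A) (over bs)"
  by (simp add: base_def over_def)

lemma base_simps: "carrier base = carrier X" "col base b = col A (col X b)"
  "eval base q bs = apply_expr (corolla q (length bs)) bs"
  by (simp_all add: base_def)

abbreviation wf_on :: "'b list \<Rightarrow> ('q, 'a) expr \<Rightarrow> bool" where
  "wf_on bs t \<equiv> wf_expr Q A (map (col A) (over bs)) t"

definition linear_on :: "'b list \<Rightarrow> ('q, 'a) expr \<Rightarrow> bool" where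
  "linear_on bs t \<longleftrightarrow> set bs \<subseteq> carrier X \<and> wf_on bs t
     \<and> (\<forall>i<length bs. count (expr_vars t) i = 1)"

lemma over_closed: "set bs \<subseteq> carrier X \<Longrightarrow> set (over bs) \<subseteq> carrier A"
  using tw.col_closed by (auto simp: over_def TwOp_simps)

lemma linear_on_planar:
  "set bs \<subseteq> carrier X \<Longrightarrow> wf_on bs t \<Longrightarrow> var_list t = [0..<length bs] \<Longrightarrow> linear_on bs t"
  using count_expr_vars_upt by (auto simp: linear_on_def)

lemma evaluable_linear:
  assumes "linear_on bs t"
  shows "evaluable (TwOp Q A) X (over bs, expr_class Q A (map (col A) (over bs)) t) bs"
proof -
  have "(over bs, expr_class Q A (map (col A) (over bs)) t) \<in> ops (TwOp Q A)"
    using assms by (intro TwOp_class_ops over_closed) (simp_all add: linear_on_def)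
  then show ?thesis using assms by (simp add: linear_on_def evaluable_def TwOp_simps(3) over_def)
qed

lemma apply_expr_closed:
  assumes "linear_on bs t"
  shows "apply_expr t bs \<in> carrier X" "col X (apply_expr t bs) = val (over bs) t"
  using evaluable_linear[OF assms] result_TwOp_class[OF over_closed, of bs t] assms
    tw.eval_closed tw.col_eval
  by (auto simp: apply_expr_def linear_on_def)

lemma apply_expr_eq: "expr_eq Q A (map (col A) (over bs)) t u \<Longrightarrow> apply_expr t bs = apply_expr u bs"
  by (simp add: apply_expr_def expr_eq_class)

text \<open>
  The action of composites, read on representatives. The condition on colours that makes the
  composition possible holds because the colour of the result of \<open>u\<close> is the value of \<open>u\<close>.
\<close>

lemma apply_expr_graft:
  assumes u: "linear_on cs u" and t: "linear_on (as @ apply_expr u cs # as') t"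
  shows "apply_expr (expr_subst (graft_subst (length as) (length cs) u) t) (as @ cs @ as')
      = apply_expr t (as @ apply_expr u cs # as')"
    and "wf_on (as @ cs @ as') (expr_subst (graft_subst (length as) (length cs) u) t)"
proof -
  let ?bs = "as @ apply_expr u cs # as'"
  have i: "length as < length (over ?bs)" "val (over cs) u = over ?bs ! length as"
    using apply_expr_closed(2)[OF u] nth_append_length[of "over as"] by simp_all
  have c: "set (over ?bs) \<subseteq> carrier A" "set (over cs) \<subseteq> carrier A"
    using over_closed t u unfolding linear_on_def by blast+
  have w: "wf_on ?bs t" "wf_on cs u" using t u by (simp_all add: linear_on_def)
  have ins: "insert_at (over ?bs) (length as) (over cs) = over (as @ cs @ as')"
    using insert_at_split[of "over as"] by simp
  note P = pcomp_TwOp_class[OF i(1) c w i(2), unfolded ins]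
  show "wf_on (as @ cs @ as') (expr_subst (graft_subst (length as) (length cs) u) t)"
    using P(2) by simp
  have "apply_expr (expr_subst (graft_subst (length as) (length cs) u) t) (as @ cs @ as')
      = eval X (pcomp (TwOp Q A) (over ?bs, expr_class Q A (map (col A) (over ?bs)) t) (length as)
         (over cs, expr_class Q A (map (col A) (over cs)) u)) (as @ cs @ as')"
    unfolding P(1) by (simp add: apply_expr_def)
  also have "\<dots> = apply_expr t ?bs"
    using tw.eval_pcomp[OF evaluable_linear[OF u]] evaluable_linear[OF t]
    by (simp only: apply_expr_def)
  finally show "apply_expr (expr_subst (graft_subst (length as) (length cs) u) t) (as @ cs @ as')
      = apply_expr t ?bs" .
qed

lemma apply_expr_reorder:
  assumes t: "linear_on bs t" and \<sigma>: "\<sigma> permutes {..<length bs}"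
  shows "apply_expr (expr_subst (\<lambda>j. Var (inv \<sigma> j)) t) (permute_list \<sigma> bs) = apply_expr t bs"
    and "wf_on (permute_list \<sigma> bs) (expr_subst (\<lambda>j. Var (inv \<sigma> j)) t)"
proof -
  have \<sigma>': "\<sigma> permutes {..<length (over bs)}" using \<sigma> by simp
  note P = act_TwOp_class[OF \<sigma>' over_closed, of t, folded over_permute[OF \<sigma>]]
  show "wf_on (permute_list \<sigma> bs) (expr_subst (\<lambda>j. Var (inv \<sigma> j)) t)"
    using P(2) t by (simp add: linear_on_def)
  show "apply_expr (expr_subst (\<lambda>j. Var (inv \<sigma> j)) t) (permute_list \<sigma> bs) = apply_expr t bs"
    using tw.eval_act[OF evaluable_linear[OF t] \<sigma>] P(1) t
    by (simp add: apply_expr_def linear_on_def)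
qed

lemma apply_Var: "b \<in> carrier X \<Longrightarrow> apply_expr (Var 0) [b] = b"
  using tw.eval_unit by (simp add: apply_expr_def TwOp_simps)

lemma linear_on_corolla:
  "linear_on bs (corolla q (length bs)) \<longleftrightarrow> evaluable Q base q bs"
proof -
  have "i < length bs \<Longrightarrow> count (expr_vars (corolla q (length bs))) i = 1" for i
    by (rule count_expr_vars_upt[OF var_list_corolla])
  then show ?thesis
    using wf_corolla[of Q A "map (col A) (over bs)" q]
    by (auto simp: linear_on_def evaluable_def col_base base_simps(1))
qed

text \<open>
  Each axiom expresses a relation between expressions such as
  \<open>(q \<circ>\<^sub>i r)(x\<^sub>0,\<dots>) = q(x\<^sub>0,\<dots>,r(\<dots>),\<dots>)\<close>, whose sides are classes of twisted arrow operations.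
\<close>

lemma base_algebra: "operad_algebra Q base"
proof
  fix b assume "b \<in> carrier base"
  then have b: "b \<in> carrier X" by (simp add: base_simps)
  then have a: "col X b \<in> carrier A" using over_closed[of "[b]"] by simp
  then show c: "col base b \<in> colours Q" by (simp add: base_simps col_closed)
  have "expr_eq Q A (map (col A) (over [b])) (corolla (unit Q (col A (col X b))) 1) (Var 0)"
    using expr_unit[of Q A "map (col A) (over [b])" "Var 0"] by (simp add: corolla_def)
  then show "eval base (unit Q (col base b)) [b] = b"
    using apply_expr_eq[of "[b]"] apply_Var[OF b] by (simp add: base_simps)
next
  fix q bs assume "evaluable Q base q bs"
  then have l: "linear_on bs (corolla q (length bs))" by (simp add: linear_on_corolla)
  show "eval base q bs \<in> carrier base" using apply_expr_closed(1)[OF l] by (simp add: base_simps)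
  have "col A (val (over bs) (corolla q (length bs))) = result Q q"
    using val_wf(2)[OF over_closed, of bs "corolla q (length bs)"] l
    by (simp add: linear_on_def corolla_def)
  then show "col base (eval base q bs) = result Q q"
    using apply_expr_closed(2)[OF l] by (simp add: base_simps)
  fix \<sigma> assume \<sigma>: "\<sigma> permutes {..<length bs}"
  let ?cs = "map (col A) (over (permute_list \<sigma> bs))"
  have ren: "expr_subst (\<lambda>j. Var (inv \<sigma> j)) (corolla q (length bs))
      = App q (map (\<lambda>j. Var (inv \<sigma> j)) [0..<length bs])"
    by (simp add: corolla_def comp_def)
  have perm: "permute_list \<sigma> (map (\<lambda>j. Var (inv \<sigma> j)) [0..<length bs]) = map Var [0..<length bs]"
    using permutes_in_image[OF \<sigma>] by (auto simp: permute_list_def permutes_inverses[OF \<sigma>])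
  have "expr_eq Q A ?cs (App (act Q q \<sigma>)
        (permute_list \<sigma> (map (\<lambda>j. Var (inv \<sigma> j)) [0..<length bs])))
      (App q (map (\<lambda>j. Var (inv \<sigma> j)) [0..<length bs]))"
    using apply_expr_reorder(2)[OF l \<sigma>] \<sigma> unfolding ren by (intro expr_act) simp_all
  from apply_expr_eq[OF this[unfolded perm]]
  show "eval base (act Q q \<sigma>) (permute_list \<sigma> bs) = eval base q bs"
    using apply_expr_reorder(1)[OF l \<sigma>, unfolded ren] by (simp add: base_simps corolla_def)
next
  fix r cs q as as'
  assume r: "evaluable Q base r cs" and q: "evaluable Q base q (as @ eval base r cs # as')"
  let ?u = "corolla r (length cs) :: ('q, 'a) expr"
  let ?bs = "as @ apply_expr ?u cs # as'" and ?n = "length as + length cs + length as'"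
  let ?ts = "map Var [0..<length as] :: ('q, 'a) expr list"
  let ?us = "map Var [length as..<length as + length cs] :: ('q, 'a) expr list"
  let ?ts' = "map Var [length as + length cs..<?n] :: ('q, 'a) expr list"
  have u: "linear_on cs ?u" using r by (simp add: linear_on_corolla)
  have t: "linear_on ?bs (corolla q (length ?bs))" using q by (simp only: linear_on_corolla base_simps)
  have "expr_subst (\<lambda>j. Var (length as + j)) ?u = App r ?us"
    by (auto simp: corolla_def intro!: nth_equalityI)
  then have g: "expr_subst (graft_subst (length as) (length cs) ?u) (corolla q (length ?bs))
      = App q (?ts @ App r ?us # ?ts')"
    using graft_corolla[of "length as" "length cs" ?u q "length as'"] by simp
  note G = apply_expr_graft[OF u t, unfolded g]
  have "?ts @ ?us @ ?ts' = map Var [0..<?n]"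
    using upt_add_eq_append[of 0 "length as" "length cs"]
      upt_add_eq_append[of 0 "length as + length cs" "length as'"] by simp
  then have "expr_eq Q A (map (col A) (over (as @ cs @ as')))
      (corolla (pcomp Q q (length as) r) ?n) (App q (?ts @ App r ?us # ?ts'))"
    using expr_pcomp[OF G(2)] by (simp add: corolla_def)
  from apply_expr_eq[OF this]
  show "eval base (pcomp Q q (length as) r) (as @ cs @ as') = eval base q (as @ eval base r cs # as')"
    using G(1) by (simp add: base_simps add.assoc)
qed

text \<open>
  Induction on the size of \<open>t\<close>. In \<open>q(t\<^sub>0,\<dots>,t\<^bsub>n-1\<^esub>)\<close> the arguments are grafted one after the other,
  from left to right, onto \<open>q(x\<^sub>0,\<dots>,x\<^bsub>n-1\<^esub>)\<close>; each argument, with its variables renumbered from 0, is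
  planar and smaller than \<open>t\<close>. Planarity is needed because partial composition inserts variables
  as a block of consecutive ones.
\<close>

lemma apply_planar:
  assumes "set bs \<subseteq> carrier X" "wf_on bs t" "var_list t = [0..<length bs]"
  shows "apply_expr t bs = expr_value base incl bs t"
  using assms
proof (induction "size t" arbitrary: t bs rule: less_induct)
  case (less t bs)
  have len: "length (var_list t) = length bs" by (simp add: less(4))
  show ?case
  proof (cases t)
    case (Var j)
    then obtain b where b: "bs = [b]" using len by (cases bs) auto
    then show ?thesis using less(2,4) Var apply_Var[of b] by simp
  next
    case (Elem a)
    then have "bs = []" using len by simp
    then show ?thesis using less(3) Elem by (simp add: incl_def)
  next
    case (App q ts)
    \<comment> \<open>An initial segment \<open>us\<close> of the arguments has been grafted; the other inputs of \<open>q\<close> are variables.\<close>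
    have key: "apply_expr (App q (us @ map Var [length as..<length as + length cs])) (as @ cs)
        = eval base q (map (expr_value base incl (as @ cs)) us @ cs)"
      if "set us \<subseteq> set ts" "concat (map var_list us) = [0..<length as]"
        "set (as @ cs) \<subseteq> carrier X"
        "wf_on (as @ cs) (App q (us @ map Var [length as..<length as + length cs]))" for us as cs
      using that
    proof (induction us arbitrary: as cs rule: rev_induct)
      case Nil
      have "as = []" using arg_cong[OF Nil(2), of length] by simp
      then show ?case by (simp add: base_simps corolla_def)
    next
      case (snoc u us)
      \<comment> \<open>The variables \<open>as\<close> split into those of \<open>us\<close>, which are \<open>xs\<close>, and those of \<open>u\<close>, which are \<open>ys\<close>.\<close>
      define k where "k = length (concat (map var_list us))"
      define xs where "xs = take k as"
      define ys where "ys = drop k as"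
      have vl: "concat (map var_list us) @ var_list u = [0..<length as]" using snoc(3) by simp
      then have "k + length (var_list u) = length as" unfolding k_def
        by (metis length_append length_upt diff_zero)
      then have k: "k \<le> length as" by simp
      have as: "as = xs @ ys" and len: "length xs = k" using k by (simp_all add: xs_def ys_def)
      have "concat (map var_list us) = take k ([0..<length as])" "var_list u = drop k [0..<length as]"
        unfolding vl[symmetric] k_def by simp_all
      then have vus: "concat (map var_list us) = [0..<length xs]"
        and vu: "var_list u = [length xs..<length xs + length ys]"
        using k by (simp_all add: len as take_upt)
      let ?u = "expr_subst (\<lambda>j. Var (j - length xs)) u"
      have u: "u \<in> set ts" using snoc(2) by simp
      have wu: "wf_on (as @ cs) u" using snoc(5) by simp
      have cu: "wf_on ys ?u
          \<and> expr_col Q A (map (col A) (over ys)) ?u = expr_col Q A (map (col A) (over (as @ cs))) u"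
        by (rule wf_expr_subst[OF _ wu]) (auto simp: vu as nth_append)
      have ys: "set ys \<subseteq> carrier X" using snoc(4) as by auto
      have "map (\<lambda>j. j - length xs) [length xs..<length xs + length ys] = [0..<length ys]"
        by (rule nth_equalityI) auto
      then have vu': "var_list ?u = [0..<length ys]" by (simp add: var_list_rename vu)
      have "size ?u < size t" using u unfolding App size_rename
        by (simp add: size_list_estimation less_Suc_eq_le size_list_estimation')
      from less(1)[OF this ys] cu vu'
      have IHu: "apply_expr ?u ys = expr_value base incl ys ?u" by simp
      have lu: "linear_on ys ?u" using linear_on_planar ys cu vu' by blast
      define b where "b = apply_expr ?u ys"
      have b: "b \<in> carrier X" "col A (col X b) = expr_col Q A (map (col A) (over (as @ cs))) u"
        using apply_expr_closed[OF lu] val_wf(2)[OF over_closed[OF ys], of ?u] cu by (simp_all add: b_def)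
      \<comment> \<open>\<open>?t\<close> is the stage before the grafting of \<open>u\<close>, with a variable for \<open>u\<close> that has the value \<open>b\<close>.\<close>
      let ?zs = "map Var [length xs..<length xs + length (b # cs)] :: ('q, 'a) expr list"
      let ?t = "App q (us @ ?zs)"
      have bc: "set (xs @ b # cs) \<subseteq> carrier X" using snoc(4) as b(1) by auto
      have less_k: "j < length xs" if "v \<in> set us" "j \<in> set (var_list v)" for v j
      proof -
        have "j \<in> set (concat (map var_list us))" using that by auto
        then show ?thesis unfolding vus by simp
      qed
      have wv: "wf_on (xs @ b # cs) v
          \<and> expr_col Q A (map (col A) (over (xs @ b # cs))) v = expr_col Q A (map (col A) (over (as @ cs))) v"
        if v: "v \<in> set us" for v
      proof -
        have "wf_on (as @ cs) v" using snoc(5) v by simp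
        then have "wf_on (xs @ b # cs) (expr_subst Var v)
          \<and> expr_col Q A (map (col A) (over (xs @ b # cs))) (expr_subst Var v)
            = expr_col Q A (map (col A) (over (as @ cs))) v"
          by (intro wf_expr_subst) (auto simp: as nth_append dest!: less_k[OF v])
        then show ?thesis by (simp only: expr_subst_Var)
      qed
      have zs: "map (expr_col Q A (map (col A) (over (xs @ b # cs)))) ?zs
          = col A (col X b) # map (col A) (over cs)"
        by (rule nth_equalityI) (auto simp: nth_append nth_Cons' simp del: upt_Suc)
      have zs': "map (expr_col Q A (map (col A) (over (as @ cs))))
            (map Var [length as..<length as + length cs]) = map (col A) (over cs)"
        by (rule nth_equalityI) (auto simp: nth_append)
      have inq: "map (expr_col Q A (map (col A) (over (as @ cs)))) (us @ [u])
          @ map (col A) (over cs) = inputs Q q" and qo: "q \<in> ops Q"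
        using snoc(5) zs' by auto
      have cus: "map (expr_col Q A (map (col A) (over (xs @ b # cs)))) us
          = map (expr_col Q A (map (col A) (over (as @ cs)))) us" using wv by simp
      then have "map (expr_col Q A (map (col A) (over (xs @ b # cs)))) (us @ ?zs) = inputs Q q"
        unfolding map_append zs cus b(2) using inq by simp
      then have wt: "wf_on (xs @ b # cs) ?t"
        using qo wv by (auto simp del: over_simps(2,3) upt_Suc simp: over_simps(4))
      have vz: "concat (map var_list ?zs) = [length xs..<length (xs @ b # cs)]"
        by (simp add: comp_def concat_map_singleton del: upt_Suc)
      have vt: "var_list ?t = [0..<length (xs @ b # cs)]"
        using vus vz upt_add_eq_append[of 0 "length xs" "length (b # cs)"]
        by (simp del: upt_Suc map_map list.map)
      have lt: "linear_on (xs @ b # cs) ?t" by (rule linear_on_planar[OF bc wt vt])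
      have sv: "expr_subst (graft_subst (length xs) (length ys) ?u) v = v" if "v \<in> set us" for v
        using less_k[OF that] by (intro expr_subst_id) (simp add: graft_subst_def)
      have su: "expr_subst (\<lambda>j. Var (length xs + j)) ?u = u"
        unfolding expr_subst_subst by (rule expr_subst_id) (simp add: vu)
      have sz: "map (expr_subst (graft_subst (length xs) (length ys) ?u)) ?zs
          = u # map Var [length as..<length as + length cs]"
        using su by (intro nth_equalityI) (auto simp: graft_subst_def as nth_Cons' simp del: upt_Suc)
      have gt: "expr_subst (graft_subst (length xs) (length ys) ?u) ?t
          = App q ((us @ [u]) @ map Var [length as..<length as + length cs])"
        using sv sz by (simp add: map_idI del: upt_Suc map_map)
      have "apply_expr (App q ((us @ [u]) @ map Var [length as..<length as + length cs])) (as @ cs)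
          = apply_expr ?t (xs @ b # cs)"
        using apply_expr_graft(1)[OF lu lt[unfolded b_def]] unfolding gt[symmetric] by (simp add: as b_def)
      also have "\<dots> = eval base q (map (expr_value base incl (xs @ b # cs)) us @ b # cs)"
        using snoc(2) by (intro snoc(1)[OF _ vus bc wt]) simp
      also have "map (expr_value base incl (xs @ b # cs)) us = map (expr_value base incl (as @ cs)) us"
        using less_k by (auto intro!: expr_value_cong simp: as nth_append)
      also have "b = expr_value base incl (as @ cs) u"
        unfolding b_def IHu by (rule expr_value_subst) (auto simp: vu as nth_append)
      finally show ?case by simp
    qed
    show ?thesis using key[of ts bs "[]"] less(2-4) by (simp add: App)
  qed
qed

text \<open>
  If \<open>\<sigma>\<close> lists the variables of \<open>t\<close> in the order of their occurrence, then renaming by the inverse of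
  \<open>\<sigma>\<close>, which is the action of \<open>\<sigma>\<close>, makes \<open>t\<close> planar.
\<close>

lemma apply_linear:
  assumes t: "linear_on bs t"
  shows "apply_expr t bs = expr_value base incl bs t"
proof -
  let ?n = "length bs" and ?v = "var_list t"
  have w: "wf_on bs t" and bs: "set bs \<subseteq> carrier X" using t by (simp_all add: linear_on_def)
  have lt: "j < ?n" if "j \<in> set ?v" for j using var_list_less[OF w that] by simp
  have c: "count (mset ?v) j = 1" if "j < ?n" for j
    using t that by (simp add: linear_on_def mset_var_list)
  have "count (mset ?v) j = (if j \<in> set ?v then 1 else 0)" for j
    using c lt by (cases "j \<in> set ?v") (auto simp: count_eq_zero_iff)
  then have d: "distinct ?v" unfolding distinct_count_atmost_1 by blast
  have "j \<in> set ?v" if "j < ?n" for j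
    using c[OF that] by (metis count_eq_zero_iff set_mset_mset zero_neq_one)
  then have s: "set ?v = {..<?n}" using lt by auto
  then have len: "length ?v = ?n" using distinct_card[OF d] by simp
  \<comment> \<open>\<open>\<sigma> k\<close> is the variable at the \<open>k\<close>-th leaf, so that the new variable \<open>y\<^sub>k = x\<^bsub>\<sigma> k\<^esub>\<close> is there.\<close>
  define \<sigma> where "\<sigma> k = (if k < ?n then ?v ! k else k)" for k
  have "bij_betw ((!) ?v) {..<?n} {..<?n}" using bij_betw_nth[OF d, of "{..<?n}"] len s by simp
  then have "bij_betw \<sigma> {..<?n} {..<?n}" by (subst bij_betw_cong[of _ _ "(!) ?v"]) (simp_all add: \<sigma>_def)
  then have \<sigma>: "\<sigma> permutes {..<?n}" by (rule bij_imp_permutes) (simp add: \<sigma>_def)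
  let ?t = "expr_subst (\<lambda>j. Var (inv \<sigma> j)) t"
  have "map (inv \<sigma>) ?v = [0..<?n]"
  proof (rule nth_equalityI)
    fix i assume "i < length (map (inv \<sigma>) ?v)"
    then have "i < ?n" using len by simp
    then show "map (inv \<sigma>) ?v ! i = [0..<?n] ! i"
      using permutes_inverses(2)[OF \<sigma>, of i] len by (simp add: \<sigma>_def)
  qed (simp add: len)
  then have "var_list ?t = [0..<length (permute_list \<sigma> bs)]" by (simp add: var_list_rename)
  then have "apply_expr ?t (permute_list \<sigma> bs) = expr_value base incl (permute_list \<sigma> bs) ?t"
    using apply_expr_reorder(2)[OF t \<sigma>] bs \<sigma> by (intro apply_planar) simp_all
  then show ?thesis
    using apply_expr_reorder(1)[OF t \<sigma>] value_reorder[OF \<sigma> w] by simp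
qed

lemma linear_on_Elem: "a \<in> carrier A \<Longrightarrow> linear_on [] (Elem a)"
  by (simp add: linear_on_def)

text \<open>
  The twisted arrow operations \<open>[q(a\<^sub>0,\<dots>,a\<^bsub>n-1\<^esub>)]\<close> and \<open>[a]\<close> with \<open>a = q(a\<^sub>0,\<dots>,a\<^bsub>n-1\<^esub>)\<close> are equal by the
  definition of the coproduct, and \<open>apply_planar\<close> evaluates the first one in \<open>base\<close>.
\<close>

lemma incl_hom: "incl \<in> algebra_hom Q A base"
proof -
  have c: "incl a \<in> carrier base" "col X (incl a) = a" if "a \<in> carrier A" for a
    using apply_expr_closed[OF linear_on_Elem[OF that]] that by (simp_all add: incl_def base_simps)
  moreover have "incl (eval A q as) = eval base q (map incl as)" if e: "evaluable Q A q as" for q as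
  proof -
    have as: "set as \<subseteq> carrier A" "q \<in> ops Q" "map (col A) as = inputs Q q"
      using e by (simp_all add: evaluable_def)
    have v: "var_list (App q (map Elem as)) = []" by simp
    have w: "wf_on [] (App q (map Elem as))" using as by (auto simp: comp_def)
    have "incl (eval A q as) = apply_expr (Elem (eval A q as)) []"
      using eval_closed[OF e] by (simp add: incl_def)
    also have "\<dots> = apply_expr (App q (map Elem as)) []"
      by (rule apply_expr_eq[symmetric, OF expr_eval[OF e]])
    also have "\<dots> = expr_value base incl [] (App q (map Elem as))"
      using w v by (intro apply_planar) simp_all
    finally show ?thesis by (simp add: comp_def)
  qed
  ultimately show ?thesis by (auto simp: algebra_hom_def base_simps incl_def)
qed

lemma proj_incl: "a \<in> carrier A \<Longrightarrow> proj (incl a) = a"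
  using apply_expr_closed[OF linear_on_Elem] by (simp add: proj_def incl_def)

lemma proj_hom: "proj \<in> algebra_hom Q base A"
proof -
  have "proj (eval base q bs) = eval A q (map proj bs)" if e: "evaluable Q base q bs" for q bs
  proof -
    have l: "linear_on bs (corolla q (length bs))" using e by (simp add: linear_on_corolla)
    have "map proj bs = over bs" using e by (auto simp: proj_def over_def evaluable_def base_simps)
    then show ?thesis
      using apply_expr_closed[OF l] expr_value_corolla[of A "\<lambda>a. a" "over bs" q]
      by (simp add: base_simps proj_def)
  qed
  moreover have "col X b \<in> carrier A" if "b \<in> carrier X" for b using over_closed[of "[b]"] that by simp
  ultimately show ?thesis by (auto simp: algebra_hom_def base_simps proj_def)
qed

lemma same_algebra_retract_base:
  "same_algebra (TwOp Q A) X (twisted_of_retract (base, proj, incl))"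
proof -
  have "eval X x bs = eval (twisted_of_retract (base, proj, incl)) x bs"
    if e: "evaluable (TwOp Q A) X x bs" for x bs
    using e
  proof (rule evaluable_TwOpE)
    fix t assume "x = (map (col X) bs, expr_class Q A (map (col A) (map (col X) bs)) t)"
      "set bs \<subseteq> carrier X" "wf_expr Q A (map (col A) (map (col X) bs)) t"
      "\<And>i. i < length bs \<Longrightarrow> count (expr_vars t) i = 1"
    then have x: "x = (over bs, expr_class Q A (map (col A) (over bs)) t)" and l: "linear_on bs t"
      unfolding over_def linear_on_def by blast+
    have "eval X x bs = expr_value base incl bs t"
      using apply_linear[OF l] by (simp add: x apply_expr_def)
    also have "\<dots> = elem_value base incl bs (expr_class Q A (map (col base) bs) t)"
      using l elem_value_class[OF base_algebra incl_hom, of bs t]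
      unfolding col_base linear_on_def base_simps(1) by simp
    finally show ?thesis unfolding col_base by (simp add: x twisted_of_retract_simps)
  qed
  then show ?thesis by (simp add: same_algebra_def twisted_of_retract_simps base_simps proj_def)
qed

end

section \<open>The equivalence of categories\<close>

lemma algebra_hom_compose:
  assumes A: "operad_algebra Q A" and h: "h \<in> algebra_hom Q A B" and k: "k \<in> algebra_hom Q B C"
  shows "compose (carrier A) k h \<in> algebra_hom Q A C"
proof -
  have "compose (carrier A) k h (eval A q as) = eval C q (map (compose (carrier A) k h) as)"
    if e: "evaluable Q A q as" for q as
  proof -
    have "map (compose (carrier A) k h) as = map k (map h as)"
      using e by (auto simp: compose_def evaluable_def)
    moreover have "k (h (eval A q as)) = eval C q (map k (map h as))"
      using h k e evaluable_hom[OF h e] by (simp add: algebra_hom_def del: map_map)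
    ultimately show ?thesis by (simp only: compose_eq[OF operad_algebra.eval_closed[OF A e]])
  qed
  moreover have "compose (carrier A) k h \<in> carrier A \<rightarrow>\<^sub>E carrier C"
    "\<forall>a\<in>carrier A. col C (compose (carrier A) k h a) = col A a"
    using h k by (auto simp: algebra_hom_def compose_def PiE_iff)
  ultimately show ?thesis unfolding algebra_hom_def by blast
qed

lemma compose_restrict_id:
  assumes "h \<in> algebra_hom Q X Y"
  shows "compose (carrier X) h (restrict (\<lambda>b. b) (carrier X)) = h"
    and "compose (carrier X) (restrict (\<lambda>b. b) (carrier Y)) h = h"
proof -
  have h: "h \<in> carrier X \<rightarrow> carrier Y" "h \<in> extensional (carrier X)"
    using assms by (auto simp: algebra_hom_def PiE_iff)
  show "compose (carrier X) h (restrict (\<lambda>b. b) (carrier X)) = h" by (rule compose_Id[OF h])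
  show "compose (carrier X) (restrict (\<lambda>b. b) (carrier Y)) h = h" by (rule Id_compose[OF h])
qed

lemma compose_assoc_hom:
  assumes "f \<in> algebra_hom Q W X"
  shows "compose (carrier W) h (compose (carrier W) g f) = compose (carrier W) (compose (carrier X) h g) f"
proof -
  have "f \<in> carrier W \<rightarrow> carrier X" using assms by (auto simp: algebra_hom_def PiE_iff)
  then show ?thesis by (rule compose_assoc)
qed

lemma algebra_category_simps:
  "X \<in> Obj (algebra_category Q) \<longleftrightarrow> operad_algebra Q X"
  "Hom (algebra_category Q) X Y = algebra_hom Q X Y"
  "Ident (algebra_category Q) X = restrict (\<lambda>b. b) (carrier X)"
  "Comp (algebra_category Q) X Y Z k h = compose (carrier X) k h"
  by (simp_all add: algebra_category_def)

lemma category_algebra_category: "category (algebra_category Q)"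
proof (unfold_locales; unfold algebra_category_simps)
  show "restrict (\<lambda>b. b) (carrier X) \<in> algebra_hom Q X X" if "operad_algebra Q X" for X
    by (rule operad_algebra.id_hom[OF that])
qed (rule algebra_hom_compose compose_restrict_id compose_assoc_hom; assumption)+

lemma over_under_simps:
  "(B, f, g) \<in> Obj (over_under_category Q A) \<longleftrightarrow> operad_algebra Q B \<and> f \<in> algebra_hom Q B A
     \<and> g \<in> algebra_hom Q A B \<and> (\<forall>a\<in>carrier A. f (g a) = a)"
  "h \<in> Hom (over_under_category Q A) (B, f, g) (B', f', g') \<longleftrightarrow> h \<in> algebra_hom Q B B'
     \<and> (\<forall>b\<in>carrier B. f' (h b) = f b) \<and> (\<forall>a\<in>carrier A. h (g a) = g' a)"
  "Ident (over_under_category Q A) (B, f, g) = restrict (\<lambda>b. b) (carrier B)"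
  "Comp (over_under_category Q A) (B, f, g) Y Z k h = compose (carrier B) k h"
  by (simp_all add: over_under_category_def)

lemma hom_closed: "h \<in> algebra_hom Q A B \<Longrightarrow> a \<in> carrier A \<Longrightarrow> h a \<in> carrier B"
  by (auto simp: algebra_hom_def)

lemma category_over_under_category: "category (over_under_category Q A)"
proof
  fix X assume "X \<in> Obj (over_under_category Q A)"
  then show "Ident (over_under_category Q A) X \<in> Hom (over_under_category Q A) X X"
    by (cases X) (auto simp: over_under_simps operad_algebra.id_hom hom_closed)
next
  fix X Y Z f g
  assume *: "X \<in> Obj (over_under_category Q A)" "Y \<in> Obj (over_under_category Q A)"
    "Z \<in> Obj (over_under_category Q A)" "f \<in> Hom (over_under_category Q A) X Y"
    "g \<in> Hom (over_under_category Q A) Y Z"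
  obtain B p i where X: "X = (B, p, i)" by (rule prod_cases3)
  obtain B' p' i' where Y: "Y = (B', p', i')" by (rule prod_cases3)
  obtain B'' p'' i'' where Z: "Z = (B'', p'', i'')" by (rule prod_cases3)
  from * show "Comp (over_under_category Q A) X Y Z g f \<in> Hom (over_under_category Q A) X Z"
    by (auto simp: X Y Z over_under_simps algebra_hom_compose hom_closed)
      (auto simp: compose_def hom_closed dest: hom_closed)
next
  fix X Y f
  assume *: "X \<in> Obj (over_under_category Q A)" "Y \<in> Obj (over_under_category Q A)"
    "f \<in> Hom (over_under_category Q A) X Y"
  obtain B p i where X: "X = (B, p, i)" by (rule prod_cases3)
  obtain B' p' i' where Y: "Y = (B', p', i')" by (rule prod_cases3)
  note XY = X Y
  have h: "f \<in> algebra_hom Q B B'" using * by (simp add: XY over_under_simps)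
  show "Comp (over_under_category Q A) X X Y f (Ident (over_under_category Q A) X) = f"
    "Comp (over_under_category Q A) X Y Y (Ident (over_under_category Q A) Y) f = f"
    using compose_restrict_id[OF h] by (simp_all add: XY over_under_simps)
next
  fix W X Y Z f g h
  assume *: "f \<in> Hom (over_under_category Q A) W X"
  obtain B p i where W: "W = (B, p, i)" by (rule prod_cases3)
  obtain B' p' i' where X': "X = (B', p', i')" by (rule prod_cases3)
  note X = W X'
  have h: "f \<in> algebra_hom Q B B'" using * by (simp add: X over_under_simps)
  show "Comp (over_under_category Q A) W Y Z h (Comp (over_under_category Q A) W X Y g f)
      = Comp (over_under_category Q A) W X Z (Comp (over_under_category Q A) X Y Z h g) f"
    using compose_assoc_hom[OF h] by (cases Y) (simp add: X over_under_simps)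
qed

lemma same_algebra_isomorphism:
  assumes "same_algebra Q X Y" "operad_algebra Q X"
  shows "isomorphism (algebra_category Q) X Y (restrict (\<lambda>b. b) (carrier X))"
proof -
  have "carrier Y = carrier X" using assms(1) by (simp add: same_algebra_def)
  then show ?thesis
    using same_algebra_hom[OF assms] compose_restrict_id(1)[OF operad_algebra.id_hom[OF assms(2)]]
    by (auto simp: isomorphism_def algebra_category_simps)
qed

definition retract_of_twisted :: "('c, 'q) operad \<Rightarrow> ('c, 'q, 'a) algebra
    \<Rightarrow> ('a, 'a list \<times> ('q, 'a) expr set, 'b) algebra
    \<Rightarrow> ('c, 'q, 'b) algebra \<times> ('b \<Rightarrow> 'a) \<times> ('a \<Rightarrow> 'b)" where
  "retract_of_twisted Q A X =
     (twisted_algebra.base Q A X, twisted_algebra.proj X, twisted_algebra.incl Q A X)"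

context operad_with_algebra
begin

lemma twisted_algebraI: "operad_algebra (TwOp Q A) X \<Longrightarrow> twisted_algebra Q A X"
  by (simp add: twisted_algebra_def operad_with_algebra_axioms)

text \<open>
  A map \<open>h\<close> of algebras of the twisted arrow operad commutes with every operation, in particular with
  those that define \<open>base\<close> and \<open>incl\<close>, and it preserves the colours, that is, \<open>proj\<close>.
\<close>

lemma hom_retract_of_twisted:
  assumes X: "operad_algebra (TwOp Q A) X" and Y: "operad_algebra (TwOp Q A) Y"
    and h: "h \<in> algebra_hom (TwOp Q A) X Y"
  shows "h \<in> Hom (over_under_category Q A) (retract_of_twisted Q A X) (retract_of_twisted Q A Y)"
proof -
  interpret X: twisted_algebra Q A X by (rule twisted_algebraI[OF X])
  interpret Y: twisted_algebra Q A Y by (rule twisted_algebraI[OF Y])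
  have hc: "h b \<in> carrier Y" "col Y (h b) = col X b" if "b \<in> carrier X" for b
    using h that by (auto simp: algebra_hom_def)
  have ap: "h (X.apply_expr t bs) = Y.apply_expr t (map h bs)" if l: "X.linear_on bs t" for t bs
  proof -
    have "Y.over (map h bs) = X.over bs"
      using l hc by (auto simp: X.over_def Y.over_def X.linear_on_def)
    then show ?thesis using h X.evaluable_linear[OF l]
      by (simp add: algebra_hom_def X.apply_expr_def Y.apply_expr_def)
  qed
  have "h (eval X.base q bs) = eval Y.base q (map h bs)" if "evaluable Q X.base q bs" for q bs
    using ap that by (simp add: X.base_simps Y.base_simps X.linear_on_corolla)
  moreover have "h \<in> carrier X \<rightarrow>\<^sub>E carrier Y" using h by (simp add: algebra_hom_def)
  ultimately show ?thesis
    using hc ap[OF X.linear_on_Elem]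
    by (auto simp: retract_of_twisted_def over_under_simps algebra_hom_def X.base_simps Y.base_simps
        X.proj_def Y.proj_def X.incl_def Y.incl_def)
qed

lemma retract_of_twisted_Obj:
  assumes "operad_algebra (TwOp Q A) X"
  shows "retract_of_twisted Q A X \<in> Obj (over_under_category Q A)"
proof -
  interpret twisted_algebra Q A X by (rule twisted_algebraI[OF assms])
  show ?thesis
    using base_algebra incl_hom proj_hom proj_incl
    by (simp add: retract_of_twisted_def over_under_simps)
qed

lemma twisted_of_retract_Obj:
  "P \<in> Obj (over_under_category Q A) \<Longrightarrow> operad_algebra (TwOp Q A) (twisted_of_retract P)"
  by (cases P) (auto simp: over_under_simps intro: operad_algebra_twisted_of_retract)

lemma hom_twisted_of_retract:
  assumes P: "P \<in> Obj (over_under_category Q A)" and P': "P' \<in> Obj (over_under_category Q A)"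
    and h: "h \<in> Hom (over_under_category Q A) P P'"
  shows "h \<in> algebra_hom (TwOp Q A) (twisted_of_retract P) (twisted_of_retract P')"
proof -
  obtain B f g where P1: "P = (B, f, g)" by (rule prod_cases3)
  obtain B' f' g' where P2: "P' = (B', f', g')" by (rule prod_cases3)
  note PP' = P1 P2
  note S = over_under_simps twisted_of_retract_simps
  have B: "operad_algebra Q B" "g \<in> algebra_hom Q A B" and f: "f \<in> algebra_hom Q B A"
    and B': "operad_algebra Q B'" "g' \<in> algebra_hom Q A B'"
    and h: "h \<in> algebra_hom Q B B'" "\<And>a. a \<in> carrier A \<Longrightarrow> h (g a) = g' a"
      "\<And>b. b \<in> carrier B \<Longrightarrow> f' (h b) = f b"
    using P P' h by (auto simp: PP' S)
  have "h (eval (twisted_of_retract P) x bs) = eval (twisted_of_retract P') x (map h bs)"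
    if "evaluable (TwOp Q A) (twisted_of_retract P) x bs" for x bs
    using that unfolding PP'
  proof (rule evaluable_TwOpE)
    fix t assume "x = (map (col (twisted_of_retract (B, f, g))) bs,
        expr_class Q A (map (col A) (map (col (twisted_of_retract (B, f, g))) bs)) t)"
      and "set bs \<subseteq> carrier (twisted_of_retract (B, f, g))"
      and "wf_expr Q A (map (col A) (map (col (twisted_of_retract (B, f, g))) bs)) t"
    note t = this[unfolded S]
    have c: "map (col A) (map f bs) = map (col B) bs"
      using t(2) f by (auto simp: algebra_hom_def)
    have c': "map (col B') (map h bs) = map (col B) bs" "set (map h bs) \<subseteq> carrier B'"
      using t(2) h(1) by (auto simp: algebra_hom_def)
    show "h (eval (twisted_of_retract (B, f, g)) x bs) = eval (twisted_of_retract (B', f', g')) x (map h bs)"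
      unfolding t(1) S c
      using elem_value_class[OF B t(2), of t] elem_value_class[OF B' c'(2), of t] t(3)
        hom_expr_value[OF B t(2) h(1,2), of t]
      unfolding c' c by simp
  qed
  then show ?thesis using h by (auto simp: algebra_hom_def PP' S)
qed

lemma same_algebra_retract_of_twisted_of_retract:
  assumes P: "P \<in> Obj (over_under_category Q A)"
  obtains B f g B' f' g' where "P = (B, f, g)" "retract_of_twisted Q A (twisted_of_retract P) = (B', f', g')"
    "same_algebra Q B B'" "\<forall>b\<in>carrier B. f' b = f b" "\<forall>a\<in>carrier A. g' a = g a"
proof -
  obtain B f g where P': "P = (B, f, g)" by (rule prod_cases3)
  have B: "operad_algebra Q B" "g \<in> algebra_hom Q A B" and f: "f \<in> algebra_hom Q B A"
    using P by (auto simp: P' over_under_simps)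
  interpret X: twisted_algebra Q A "twisted_of_retract P"
    by (rule twisted_algebraI[OF twisted_of_retract_Obj[OF P]])
  note S = twisted_of_retract_simps P'
  have fc: "col A (f b) = col B b" if "b \<in> carrier B" for b using f that by (auto simp: algebra_hom_def)
  have ap: "X.apply_expr t bs = expr_value B g bs t"
    if "set bs \<subseteq> carrier B" "wf_expr Q A (map (col B) bs) t" for t bs
  proof -
    have o: "X.over bs = map f bs" unfolding X.over_def by (simp add: S)
    have c: "map (col A) (map f bs) = map (col B) bs" using fc that(1) by auto
    have "X.apply_expr t bs = elem_value B g bs (expr_class Q A (map (col A) (map f bs)) t)"
      unfolding X.apply_expr_def o by (simp add: S)
    then show ?thesis unfolding c by (simp add: elem_value_class[OF B that])
  qed
  have "eval B q bs = eval X.base q bs" if e: "evaluable Q B q bs" for q bs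
  proof -
    have "wf_expr Q A (map (col B) bs) (corolla q (length bs))"
      using e wf_corolla[of Q A "map (col B) bs" q, unfolded length_map] unfolding evaluable_def by metis
    then show ?thesis
      using e unfolding X.base_simps by (simp add: ap evaluable_def expr_value_corolla)
  qed
  moreover have "carrier X.base = carrier B" "\<forall>b\<in>carrier B. col X.base b = col B b"
    unfolding X.base_simps using fc by (simp_all add: S)
  ultimately have "same_algebra Q B X.base" by (simp add: same_algebra_def)
  moreover have "\<forall>b\<in>carrier B. X.proj b = f b"
    unfolding X.proj_def by (simp add: S)
  moreover have "\<forall>a\<in>carrier A. X.incl a = g a"
    unfolding X.incl_def using ap[of "[]" "Elem _"] by simp
  ultimately show thesis by (rule that[OF P' retract_of_twisted_def])
qed

lemma functor_retract_of_twisted: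
  "cat_functor (algebra_category (TwOp Q A)) (over_under_category Q A)
     (retract_of_twisted Q A) (\<lambda>X Y h. h)"
  unfolding cat_functor_def cat_functor_axioms_def
  by (auto simp: category_algebra_category category_over_under_category algebra_category_simps
      retract_of_twisted_Obj hom_retract_of_twisted)
    (auto simp: retract_of_twisted_def over_under_simps
      twisted_algebra.base_simps[OF twisted_algebraI])

lemma functor_twisted_of_retract:
  "cat_functor (over_under_category Q A) (algebra_category (TwOp Q A)) twisted_of_retract (\<lambda>P P' h. h)"
  unfolding cat_functor_def cat_functor_axioms_def
  by (auto simp: category_algebra_category category_over_under_category algebra_category_simps
      over_under_simps twisted_of_retract_simps intro: twisted_of_retract_Obj hom_twisted_of_retract)

lemma TwOp_algebras_equivalent_retracts:
  "equivalent_categories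
     (algebra_category (TwOp Q A)
       :: (('a, 'a list \<times> ('q, 'a) expr set, 'b) algebra, 'b \<Rightarrow> 'b) category)
     (over_under_category Q A
       :: (('c, 'q, 'b) algebra \<times> ('b \<Rightarrow> 'a) \<times> ('a \<Rightarrow> 'b), 'b \<Rightarrow> 'b) category)"
proof -
  let ?T = "algebra_category (TwOp Q A)
    :: (('a, 'a list \<times> ('q, 'a) expr set, 'b) algebra, 'b \<Rightarrow> 'b) category"
  let ?R = "over_under_category Q A
    :: (('c, 'q, 'b) algebra \<times> ('b \<Rightarrow> 'a) \<times> ('a \<Rightarrow> 'b), 'b \<Rightarrow> 'b) category"
  let ?F = "retract_of_twisted Q A"
  have F: "cat_functor ?T ?R ?F (\<lambda>X Y h. h)" by (rule functor_retract_of_twisted)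
  have G: "cat_functor ?R ?T twisted_of_retract (\<lambda>P P' h. h)" by (rule functor_twisted_of_retract)
  have unit: "natural_iso ?T ?T (\<lambda>X. X) (\<lambda>X Y h. h) (\<lambda>X. twisted_of_retract (?F X)) (\<lambda>X Y h. h)
      (\<lambda>X. restrict (\<lambda>b. b) (carrier X))"
    unfolding natural_iso_def algebra_category_simps(2,4)
  proof (intro conjI ballI)
    fix X assume "X \<in> Obj ?T"
    then have X: "operad_algebra (TwOp Q A) X" by (simp add: algebra_category_simps)
    interpret twisted_algebra Q A X by (rule twisted_algebraI[OF X])
    show "isomorphism ?T X (twisted_of_retract (?F X)) (restrict (\<lambda>b. b) (carrier X))"
      using same_algebra_isomorphism[OF same_algebra_retract_base X]
      by (simp add: retract_of_twisted_def)
    fix Y and h :: "'b \<Rightarrow> 'b" assume h: "h \<in> algebra_hom (TwOp Q A) X Y"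
    show "compose (carrier X) (restrict (\<lambda>b. b) (carrier Y)) h
        = compose (carrier X) h (restrict (\<lambda>b. b) (carrier X))"
      by (simp only: compose_restrict_id[OF h])
  qed
  have counit: "natural_iso ?R ?R (\<lambda>P. ?F (twisted_of_retract P)) (\<lambda>P P' h. h) (\<lambda>P. P) (\<lambda>P P' h. h)
      (\<lambda>P. restrict (\<lambda>b. b) (carrier (fst P)))"
    unfolding natural_iso_def
  proof (intro conjI ballI)
    fix P assume P: "P \<in> Obj ?R"
    obtain B f g B' f' g' where E: "P = (B, f, g)" "?F (twisted_of_retract P) = (B', f', g')"
      and s: "same_algebra Q B B'" and p: "\<forall>b\<in>carrier B. f' b = f b"
      and i: "\<forall>a\<in>carrier A. g' a = g a" by (rule same_algebra_retract_of_twisted_of_retract[OF P]) blast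
    have B: "operad_algebra Q B" "g \<in> algebra_hom Q A B" using P by (simp_all add: E(1) over_under_simps)
    have c: "carrier B' = carrier B" using s by (simp add: same_algebra_def)
    have H: "restrict (\<lambda>b. b) (carrier B) \<in> Hom ?R (B, f, g) (B', f', g')"
      "restrict (\<lambda>b. b) (carrier B) \<in> Hom ?R (B', f', g') (B, f, g)"
      using same_algebra_hom[OF s B(1)] p i hom_closed[OF B(2)] by (simp_all add: over_under_simps c)
    show "isomorphism ?R (?F (twisted_of_retract P)) P (restrict (\<lambda>b. b) (carrier (fst P)))"
      unfolding isomorphism_def E(2) using H compose_restrict_id(1)[OF operad_algebra.id_hom[OF B(1)]]
      by (intro conjI bexI[of _ "restrict (\<lambda>b. b) (carrier B)"]) (simp_all add: E(1) over_under_simps c)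
    fix P' h assume P': "P' \<in> Obj ?R" and h: "h \<in> Hom ?R P P'"
    obtain C k l where P'': "P' = (C, k, l)" by (rule prod_cases3)
    have "h \<in> algebra_hom Q B C" using h by (simp add: E(1) P'' over_under_simps)
    from compose_restrict_id[OF this]
    show "Comp ?R (?F (twisted_of_retract P)) (?F (twisted_of_retract P')) P'
          (restrict (\<lambda>b. b) (carrier (fst P'))) h
        = Comp ?R (?F (twisted_of_retract P)) P P' h (restrict (\<lambda>b. b) (carrier (fst P)))"
      unfolding E(2) by (simp add: E(1) P'' over_under_simps c)
  qed
  show ?thesis
    unfolding equivalent_categories_def
    by (intro exI) (rule conjI[OF F conjI[OF G conjI[OF unit counit]]])
qed

end

theorem proposition2p8:
  fixes Q :: "('c, 'q) operad" and A :: "('c, 'q, 'a) algebra"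
  assumes "operad Q" and "operad_algebra Q A"
  shows "isomorphic_operads (TwOp Q A) (UOp (BD_plus Q A) (id_plus A))
    \<and> isomorphic_operads (TwOp Q A) (BD_plus (UOp Q A) (id_UOp A))
    \<and> equivalent_categories
        (algebra_category (TwOp Q A)
          :: (('a, 'a list \<times> ('q, 'a) expr set, 'b) algebra, 'b \<Rightarrow> 'b) category)
        (over_under_category Q A
          :: (('c, 'q, 'b) algebra \<times> ('b \<Rightarrow> 'a) \<times> ('a \<Rightarrow> 'b), 'b \<Rightarrow> 'b) category)"
proof -
  interpret operad_with_algebra Q A using assms by (simp add: operad_with_algebra_def)
  show ?thesis
    using TwOp_iso_UOp_plus TwOp_iso_plus_UOp TwOp_algebras_equivalent_retracts by blast
qed

end
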